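(* Let $\Omega\subset\mathbb{C}^n$ be a bounded domain and let $1\le p<q\le\infty$. If $E$ is a closed subspace of $A^p(\Omega)$ (with respect to the $L^p$-norm) and $E\subset A^q(\Omega)$, then $\dim E<\infty$.
   Context: For $1\le p<\infty$, $A^p(\Omega)=\{f\in\mathcal{O}(\Omega): \int_\Omega |f|^p\,dV<\infty\}$, where $\mathcal{O}(\Omega)$ is the space of holomorphic functions on $\Omega$ and $dV$ is Lebesgue measure; it is normed by $\|f\|_p=(\int_\Omega|f|^p\,dV)^{1/p}$. $A^\infty(\Omega)=\mathcal{O}(\Omega)\cap L^\infty(\Omega)$. *)

theory Defs
  imports "HOL-Analysis.Analysis"
begin

definition holomorphic_n :: "(complex^'n \<Rightarrow> complex) \<Rightarrow> (complex^'n) set \<Rightarrow> bool" where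
  "holomorphic_n f S \<longleftrightarrow>
     (\<forall>z\<in>S. \<exists>c::complex^'n. (f has_derivative (\<lambda>h. \<Sum>i\<in>UNIV. c$i * h$i)) (at z))"

definition bounded_domain :: "(complex^'n) set \<Rightarrow> bool" where
  "bounded_domain \<Omega> \<longleftrightarrow> open \<Omega> \<and> connected \<Omega> \<and> \<Omega> \<noteq> {} \<and> bounded \<Omega>"

definition Lp_int :: "real \<Rightarrow> (complex^'n) set \<Rightarrow> (complex^'n \<Rightarrow> complex) \<Rightarrow> ennreal" where
  "Lp_int p \<Omega> f = (\<integral>\<^sup>+ z\<in>\<Omega>. ennreal (norm (f z) powr p) \<partial>lebesgue)"

definition Lp_norm :: "real \<Rightarrow> (complex^'n) set \<Rightarrow> (complex^'n \<Rightarrow> complex) \<Rightarrow> real" where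
  "Lp_norm p \<Omega> f = (enn2real (Lp_int p \<Omega> f)) powr (1 / p)"

text \<open>Bergman spaces A^q(\<Omega>) for q \<in> [1,\<infinity>]. Functions are taken to vanish
  outside \<Omega> (so that a function is identified with its restriction to \<Omega>).\<close>
definition Bergman :: "ereal \<Rightarrow> (complex^'n) set \<Rightarrow> (complex^'n \<Rightarrow> complex) set" where
  "Bergman q \<Omega> = {f. holomorphic_n f \<Omega> \<and> (\<forall>z. z \<notin> \<Omega> \<longrightarrow> f z = 0) \<and>
      (if q = \<infinity> then (\<exists>C. AE z in lebesgue. z \<in> \<Omega> \<longrightarrow> norm (f z) \<le> C)
       else Lp_int (real_of_ereal q) \<Omega> f < \<infinity>)}"

definition complex_subspace :: "('a \<Rightarrow> complex) set \<Rightarrow> bool" where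
  "complex_subspace E \<longleftrightarrow> (\<lambda>z. 0) \<in> E \<and> (\<forall>f\<in>E. \<forall>g\<in>E. (\<lambda>z. f z + g z) \<in> E)
     \<and> (\<forall>c. \<forall>f\<in>E. (\<lambda>z. c * f z) \<in> E)"

definition Lp_closed_in_Bergman :: "real \<Rightarrow> (complex^'n) set \<Rightarrow> (complex^'n \<Rightarrow> complex) set \<Rightarrow> bool" where
  "Lp_closed_in_Bergman p \<Omega> E \<longleftrightarrow>
     (\<forall>F f. (\<forall>k. F k \<in> E) \<longrightarrow> f \<in> Bergman (ereal p) \<Omega> \<longrightarrow>
        (\<lambda>k. Lp_norm p \<Omega> (\<lambda>z. F k z - f z)) \<longlonglongrightarrow> 0 \<longrightarrow> f \<in> E)"

definition finite_dim_complex :: "('a \<Rightarrow> complex) set \<Rightarrow> bool" where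
  "finite_dim_complex E \<longleftrightarrow> (\<exists>B. finite B \<and> B \<subseteq> E \<and>
     (\<forall>f\<in>E. \<exists>c. \<forall>z. f z = (\<Sum>b\<in>B. c b * b z)))"

end

theory Submission
  imports Defs "HOL-Complex_Analysis.Cauchy_Integral_Formula"
begin

text \<open>
  A gliding hump argument (in place of the closed graph theorem) shows that on \<open>E\<close> the q-norm is bounded by
  a multiple of the p-norm. As q > p, elements of \<open>E\<close> then cannot concentrate on sets of small measure, so
  the mass of \<open>f\<close> outside a suitable compact set \<open>K\<close> is at most half of the total. On \<open>K\<close> the Bergman
  estimates make \<open>f\<close> Lipschitz with constant controlled by its p-norm; hence, if \<open>f\<close> vanishes on a
  sufficiently fine finite net of \<open>K\<close>, then its mass on \<open>K\<close> is at most a quarter, and \<open>f = 0\<close>. Evaluation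
  at finitely many points is thus injective on \<open>E\<close>.
\<close>

subsection \<open>Mean values over balls\<close>

text \<open>The obstacle is the boundary of \<open>\<Omega>\<close>. Interior estimates degenerate
  there, and the full Bergman space of a bounded domain is infinite-dimensional, so holomorphy alone
  cannot suffice; the gain from exponent p to q is what controls the boundary layer. There the
  values of f are split at a level l: values up to l cost at most l^p times the measure of the
  layer, larger values at most l^(p-q) times the q-integral. This forces the order of the choices:
  the bound C for the q-integrals, then l, then the measure of the layer and with it K, then the
  Lipschitz constant near K, and last the mesh of the net. The estimates concern the integrals
  \<open>Lp_int\<close>, with values in \<open>ennreal\<close>, rather than norms. Crude constants
  such as \<open>2 powr q\<close> are then harmless, because every threshold is fixed after them,
  and multiplying f by a constant just multiplies the integral. Finite dimension comes from linear
  algebra rather than from compactness of the unit ball: an injective evaluation map embeds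
  \<open>E\<close> linearly into a space of functions on finitely many points.\<close>

text \<open>Uniqueness of Haar measure specialised to isometries: integrate \<open>g (T x) * indicator (ball 0 1) (y - T x)\<close>
  over \<open>x\<close> and \<open>y\<close> in both orders; the volume of the unit ball, which \<open>T\<close> preserves, cancels.\<close>

lemma nn_integral_linear_isometry:
  fixes T :: "'a::euclidean_space \<Rightarrow> 'a" and g :: "'a \<Rightarrow> ennreal"
  assumes T: "linear T" "\<And>x. norm (T x) = norm x"
    and [measurable]: "g \<in> borel_measurable borel"
  shows "(\<integral>\<^sup>+x. g (T x) \<partial>lborel) = (\<integral>\<^sup>+x. g x \<partial>lborel)"
proof -
  have [measurable]: "T \<in> borel_measurable borel"
    by (intro borel_measurable_continuous_onI linear_continuous_on linear_linear[THEN iffD1] T)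
       (simp add: T linear_conv_bounded_linear[symmetric])
  have "inj T"
    using T by (auto simp: linear_injective_0) (metis norm_eq_zero)
  then have "surj T"
    using T(1) linear_injective_imp_surjective by blast
  then obtain S where S: "\<And>y. T (S y) = y"
    by (metis surjD)
  have shift: "(\<integral>\<^sup>+x. h (c + x) \<partial>lborel) = (\<integral>\<^sup>+x. h x \<partial>lborel)"
    if [measurable]: "h \<in> borel_measurable borel" for h :: "'a \<Rightarrow> ennreal" and c
    by (subst (2) lborel_distr_plus[of c, symmetric]) (simp add: nn_integral_distr)
  let ?b = "indicator (ball (0::'a) 1) :: 'a \<Rightarrow> ennreal"
  let ?V = "emeasure lborel (ball (0::'a) 1)"
  have [measurable]: "?b \<in> borel_measurable borel"
    by (intro borel_measurable_indicator) simp
  have V: "(\<integral>\<^sup>+y. ?b y \<partial>lborel) = ?V" by simp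
  have "(\<integral>\<^sup>+x. g (T x) \<partial>lborel) * ?V = (\<integral>\<^sup>+x. g (T x) * (\<integral>\<^sup>+y. ?b y \<partial>lborel) \<partial>lborel)"
    by (simp add: nn_integral_multc)
  also have "\<dots> = (\<integral>\<^sup>+x. g (T x) * (\<integral>\<^sup>+y. ?b (- T x + y) \<partial>lborel) \<partial>lborel)"
    by (subst shift) auto
  also have "\<dots> = (\<integral>\<^sup>+x. \<integral>\<^sup>+y. g (T x) * ?b (- T x + y) \<partial>lborel \<partial>lborel)"
    by (simp add: nn_integral_cmult)
  also have "\<dots> = (\<integral>\<^sup>+y. \<integral>\<^sup>+x. g (T x) * ?b (- T x + y) \<partial>lborel \<partial>lborel)"
    by (rule lborel_pair.Fubini') measurable
  \<comment> \<open>For fixed y, translate x by a preimage \<open>S y\<close> of y. Then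
    \<open>T (S y + x) = y + T x\<close>, so the indicator is evaluated at \<open>- T x\<close>; as
    \<open>T\<close> preserves norms, this is the indicator of the unit ball at x.\<close>
  also have "\<dots> = (\<integral>\<^sup>+y. \<integral>\<^sup>+x. g (T (S y + x)) * ?b (- T (S y + x) + y) \<partial>lborel \<partial>lborel)"
    by (subst shift[where h = "\<lambda>x. g (T x) * ?b (- T x + _)"]) auto
  also have "\<dots> = (\<integral>\<^sup>+y. \<integral>\<^sup>+x. g (T x + y) * ?b x \<partial>lborel \<partial>lborel)"
    by (simp add: linear_add[OF T(1)] S indicator_def T(2) add.commute)
  also have "\<dots> = (\<integral>\<^sup>+x. \<integral>\<^sup>+y. g (T x + y) * ?b x \<partial>lborel \<partial>lborel)"
    by (rule lborel_pair.Fubini') measurable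
  also have "\<dots> = (\<integral>\<^sup>+x. (\<integral>\<^sup>+y. g (T x + y) \<partial>lborel) * ?b x \<partial>lborel)"
    by (simp add: nn_integral_multc)
  also have "\<dots> = (\<integral>\<^sup>+x. g x \<partial>lborel) * ?V"
    by (simp add: shift nn_integral_cmult)
  finally have "?V * (\<integral>\<^sup>+x. g (T x) \<partial>lborel) = ?V * (\<integral>\<^sup>+x. g x \<partial>lborel)"
    by (simp add: mult.commute)
  moreover have "?V \<noteq> 0" 
    using content_ball_pos[of 1 "0::'a"] by (auto simp: measure_def)
  moreover have "?V \<noteq> \<infinity>"
    using emeasure_lborel_ball_finite[of "0::'a" 1] by auto
  ultimately show ?thesis
    by (simp add: ennreal_mult_cancel_left)
qed

section \<open>Restriction to complex lines and averages over circles\<close>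

lemma norm_vector_scalar_mult:
  fixes w :: "'a::real_normed_div_algebra^'n"
  shows "norm (c *s w) = norm c * norm w"
  by (simp add: norm_vec_def norm_mult L2_set_right_distrib)

lemma has_derivative_scalar_mult_left:
  fixes w :: "complex^'n"
  shows "((\<lambda>\<zeta>. z + \<zeta> *s w) has_derivative (\<lambda>k. k *s w)) (at x)"
proof -
  have "linear (\<lambda>\<zeta>. \<zeta> *s w)"
    by (rule linearI) (auto simp: vec_eq_iff algebra_simps)
  then have "((\<lambda>\<zeta>. \<zeta> *s w) has_derivative (\<lambda>k. k *s w)) (at x)"
    by (simp add: linear_conv_bounded_linear bounded_linear_imp_has_derivative)
  then show ?thesis
    by (auto intro!: derivative_eq_intros)
qed

lemma slice_has_field_derivative:
  fixes w :: "complex^'n"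
  assumes "(f has_derivative (\<lambda>h. \<Sum>i\<in>UNIV. c$i * h$i)) (at (z + x *s w))"
  shows "((\<lambda>\<zeta>. f (z + \<zeta> *s w)) has_field_derivative (\<Sum>i\<in>UNIV. c$i * w$i)) (at x)"
proof -
  have "((\<lambda>\<zeta>. f (z + \<zeta> *s w)) has_derivative (\<lambda>k. \<Sum>i\<in>UNIV. c$i * (k *s w)$i)) (at x)"
    using diff_chain_at[OF has_derivative_scalar_mult_left assms] by (simp add: o_def)
  then show ?thesis
    unfolding has_field_derivative_def
    by (rule has_derivative_eq_rhs) (auto simp: sum_distrib_right sum_distrib_left algebra_simps)
qed

lemma slice_holomorphic:
  assumes "holomorphic_n f S" "\<And>\<zeta>. \<zeta> \<in> A \<Longrightarrow> z + \<zeta> *s w \<in> S"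
  shows "(\<lambda>\<zeta>. f (z + \<zeta> *s w)) holomorphic_on A"
  unfolding holomorphic_on_def
proof
  fix x assume "x \<in> A"
  then obtain c where "(f has_derivative (\<lambda>h. \<Sum>i\<in>UNIV. c$i * h$i)) (at (z + x *s w))"
    using assms unfolding holomorphic_n_def by blast
  from slice_has_field_derivative[OF this]
  show "(\<lambda>\<zeta>. f (z + \<zeta> *s w)) field_differentiable at x within A"
    using field_differentiable_at_within field_differentiable_def by blast
qed

text \<open>Cauchy's formula at the centre of the unit circle makes \<open>g 0\<close> the average
  of g over the circle, and the triangle inequality for integrals does the rest. The nonnegative
  integral is the form to which Fubini applies when the circles are averaged over all
  directions.\<close>

lemma holomorphic_circle_mean_le:
  assumes "g holomorphic_on (cball 0 1)"
  shows "ennreal (norm (g 0)) \<le> (\<integral>\<^sup>+t\<in>{0..1}. ennreal (norm (g (exp (2 * pi * t * \<i>)))) \<partial>lborel)"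
proof -
  let ?e = "\<lambda>t::real. exp (2 * pi * t * \<i>)"
  have "((\<lambda>u. g u / (u - 0)) has_contour_integral (2 * of_real pi * \<i> * g 0)) (circlepath 0 1)"
    by (rule Cauchy_integral_circlepath_simple) (use assms in auto)
  then have "((\<lambda>t. g (?e t) * (2 * pi * \<i>)) has_integral (2 * of_real pi * \<i> * g 0)) {0..1}"
    unfolding has_contour_integral vector_derivative_circlepath
    by (simp add: circlepath algebra_simps)
  from has_integral_mult_left[OF this, of "1 / (2 * pi * \<i>)"]
  have hi: "((\<lambda>t. g (?e t)) has_integral g 0) {0..1}"
    by simp
  have "continuous_on {0..1} (\<lambda>t. g (?e t))"
    by (rule continuous_on_compose2[OF holomorphic_on_imp_continuous_on[OF assms]])
       (auto intro!: continuous_intros)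
  then have int: "set_integrable lborel {0..1} (\<lambda>t. g (?e t))"
    by (rule borel_integrable_atLeastAtMost')
  have "g 0 = (LINT t:{0..1}|lborel. g (?e t))"
    using set_borel_integral_eq_integral(2)[OF int] hi by (simp add: integral_unique)
  then have "ennreal (norm (g 0)) \<le> (\<integral>\<^sup>+t. ennreal (norm (indicator {0..1} t *\<^sub>R g (?e t))) \<partial>lborel)"
    unfolding set_lebesgue_integral_def
    using integral_norm_bound_ennreal[OF int[unfolded set_integrable_def]] by simp
  also have "\<dots> = (\<integral>\<^sup>+t\<in>{0..1}. ennreal (norm (g (?e t))) \<partial>lborel)"
    by (rule nn_integral_cong) (auto simp: indicator_def)
  finally show ?thesis .
qed

lemma holomorphic_n_continuous_on:
  assumes "holomorphic_n f S" shows "continuous_on S f"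
  using assms unfolding holomorphic_n_def
  by (meson continuous_at_imp_continuous_on has_derivative_continuous)

lemma holomorphic_n_subset: "holomorphic_n f S \<Longrightarrow> T \<subseteq> S \<Longrightarrow> holomorphic_n f T"
  unfolding holomorphic_n_def by blast

text \<open>The one-variable mean value inequality on each circle \<open>t \<mapsto> z + exp (2 * pi * t * \<i>) *s w\<close>, integrated over
  \<open>w\<close>; for fixed \<open>t\<close> the rotation of \<open>w\<close> preserves Lebesgue measure.\<close>

lemma holomorphic_n_mean_ball_le:
  fixes f :: "complex^'n \<Rightarrow> complex"
  assumes f: "holomorphic_n f (ball z r)"
  shows "ennreal (norm (f z)) * emeasure lborel (ball (0::complex^'n) r)
           \<le> (\<integral>\<^sup>+x\<in>ball z r. ennreal (norm (f x)) \<partial>lborel)"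
proof -
  let ?e = "\<lambda>t::real. exp (2 * pi * t * \<i>)"
  \<comment> \<open>Nothing is known about f off the ball, so the indicator is built in: this makes
    \<open>F\<close> Borel on the whole space. Recentring at z turns the circles into orbits of
    rotations about 0, which preserve the centred ball.\<close>
  define F where "F x = ennreal (norm (f (z + x))) * indicator (ball z r) (z + x)" for x
  have *: "(\<lambda>x. ennreal (norm (f x)) * indicator (ball z r) x) \<in> borel_measurable borel"
  proof -
    have "(\<lambda>x. indicator (ball z r) x *\<^sub>R f x) \<in> borel_measurable borel"
      by (intro borel_measurable_continuous_on_indicator holomorphic_n_continuous_on f) simp
    then have "(\<lambda>x. ennreal (norm (indicator (ball z r) x *\<^sub>R f x))) \<in> borel_measurable borel"
      by measurable
    then show ?thesis
      by (rule measurable_cong[THEN iffD1, rotated]) (auto simp: indicator_def)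
  qed
  have F[measurable]: "F \<in> borel_measurable borel"
    unfolding F_def by (rule measurable_compose[OF _ *]) measurable
  have lin: "linear (\<lambda>w::complex^'n. a *s w)" for a
    by (rule linearI) (auto simp: vec_eq_iff algebra_simps)
  have Fm[measurable]: "(\<lambda>x. F (?e (fst x) *s snd x)) \<in> borel_measurable (lborel \<Otimes>\<^sub>M lborel)"
  proof (rule measurable_compose[OF _ F])
    have "continuous_on UNIV (\<lambda>x::real \<times> (complex^'n). ?e (fst x) *s snd x)"
      unfolding vector_scalar_mult_def by (intro continuous_intros)
    then show "(\<lambda>x::real \<times> (complex^'n). ?e (fst x) *s snd x) \<in> lborel \<Otimes>\<^sub>M lborel \<rightarrow>\<^sub>M borel"
      by (simp add: lborel_prod borel_measurable_continuous_onI)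
  qed
  have "ennreal (norm (f z)) * emeasure lborel (ball (0::complex^'n) r)
     = (\<integral>\<^sup>+w\<in>ball (0::complex^'n) r. ennreal (norm (f z)) \<partial>lborel)"
    by (simp add: nn_integral_cmult_indicator)
  also have "\<dots> \<le> (\<integral>\<^sup>+w. (\<integral>\<^sup>+t\<in>{0..1}. F (?e t *s w) \<partial>lborel) \<partial>lborel)"
  proof (rule nn_integral_mono)
    fix w :: "complex^'n"
    have "ennreal (norm (f z)) \<le> (\<integral>\<^sup>+t\<in>{0..1}. F (?e t *s w) \<partial>lborel)" if "norm w < r"
    proof -
      have inball: "z + \<zeta> *s w \<in> ball z r" if "\<zeta> \<in> cball 0 1" for \<zeta>
      proof -
        have "norm (\<zeta> *s w) \<le> 1 * norm w"
          unfolding norm_vector_scalar_mult using that by (intro mult_right_mono) auto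
        then show ?thesis using \<open>norm w < r\<close> by (simp add: dist_norm)
      qed
      have "ennreal (norm (f (z + 0 *s w)))
         \<le> (\<integral>\<^sup>+t\<in>{0..1}. ennreal (norm (f (z + ?e t *s w))) \<partial>lborel)"
        by (rule holomorphic_circle_mean_le[OF slice_holomorphic[OF f inball]])
      also have "\<dots> = (\<integral>\<^sup>+t\<in>{0..1}. F (?e t *s w) \<partial>lborel)"
        unfolding F_def by (rule nn_integral_cong) (use inball in \<open>auto simp: indicator_def\<close>)
      finally show ?thesis by simp
    qed
    then show "ennreal (norm (f z)) * indicator (ball 0 r) w \<le> (\<integral>\<^sup>+t\<in>{0..1}. F (?e t *s w) \<partial>lborel)"
      by (auto simp: indicator_def)
  qed
  also have "\<dots> = (\<integral>\<^sup>+t. (\<integral>\<^sup>+w. F (?e t *s w) * indicator {0..1} t \<partial>lborel) \<partial>lborel)"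
    by (rule lborel_pair.Fubini') (unfold case_prod_beta, intro borel_measurable_times_ennreal Fm, measurable)
  also have "\<dots> = (\<integral>\<^sup>+t\<in>{0..1}. (\<integral>\<^sup>+w. F (?e t *s w) \<partial>lborel) \<partial>lborel)"
  proof (rule nn_integral_cong)
    fix t :: real
    have "(\<lambda>w. F (?e t *s w)) \<in> borel_measurable borel"
      by (rule measurable_compose[OF _ F])
         (simp add: borel_measurable_continuous_onI linear_continuous_on linear_conv_bounded_linear[symmetric] lin)
    then show "(\<integral>\<^sup>+w. F (?e t *s w) * indicator {0..1} t \<partial>lborel) = (\<integral>\<^sup>+w. F (?e t *s w) \<partial>lborel) * indicator {0..1} t"
      by (simp add: nn_integral_multc)
  qed
  also have "\<dots> = (\<integral>\<^sup>+t\<in>{0..1::real}. (\<integral>\<^sup>+w. F w \<partial>lborel) \<partial>lborel)"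
    by (subst nn_integral_linear_isometry[OF lin _ F]) (simp_all add: norm_vector_scalar_mult)
  also have "\<dots> = (\<integral>\<^sup>+w. F w \<partial>lborel)"
    by (simp add: nn_integral_cmult_indicator)
  also have "\<dots> = (\<integral>\<^sup>+x\<in>ball z r. ennreal (norm (f x)) \<partial>lborel)"
    unfolding F_def
    by (subst (2) lborel_distr_plus[of z, symmetric], subst nn_integral_distr) (use * in auto)
  finally show ?thesis .
qed

subsection \<open>Bergman estimates\<close>

lemma holomorphic_n_cmult:
  assumes "holomorphic_n f S" shows "holomorphic_n (\<lambda>z. a * f z) S"
  unfolding holomorphic_n_def
proof
  fix z assume "z \<in> S"
  then obtain c where c: "(f has_derivative (\<lambda>h. \<Sum>i\<in>UNIV. c$i * h$i)) (at z)"
    using assms unfolding holomorphic_n_def by blast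
  have "((\<lambda>z. a * f z) has_derivative (\<lambda>h. \<Sum>i\<in>UNIV. (a *s c)$i * h$i)) (at z)"
    using has_derivative_mult_right[OF c, of a] by (simp add: sum_distrib_left mult.assoc)
  then show "\<exists>c. ((\<lambda>z. a * f z) has_derivative (\<lambda>h. \<Sum>i\<in>UNIV. c$i * h$i)) (at z)"
    by blast
qed

lemma holomorphic_n_add:
  assumes "holomorphic_n f S" "holomorphic_n g S" shows "holomorphic_n (\<lambda>z. f z + g z) S"
  unfolding holomorphic_n_def
proof
  fix z assume "z \<in> S"
  then obtain c d where c: "(f has_derivative (\<lambda>h. \<Sum>i\<in>UNIV. c$i * h$i)) (at z)"
    and d: "(g has_derivative (\<lambda>h. \<Sum>i\<in>UNIV. d$i * h$i)) (at z)"
    using assms unfolding holomorphic_n_def by meson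
  have "((\<lambda>z. f z + g z) has_derivative (\<lambda>h. \<Sum>i\<in>UNIV. (c + d)$i * h$i)) (at z)"
    using has_derivative_add[OF c d] by (simp add: sum.distrib distrib_right)
  then show "\<exists>c. ((\<lambda>z. f z + g z) has_derivative (\<lambda>h. \<Sum>i\<in>UNIV. c$i * h$i)) (at z)"
    by blast
qed

lemma holomorphic_n_diff:
  assumes "holomorphic_n f S" "holomorphic_n g S" shows "holomorphic_n (\<lambda>z. f z - g z) S"
  using holomorphic_n_add[OF assms(1) holomorphic_n_cmult[OF assms(2), of "-1"]] by simp

section \<open>Scaling and differences of p-th power integrals\<close>

lemma borel_measurable_holomorphic_powr:
  assumes "open \<Omega>" "holomorphic_n f \<Omega>"
  shows "(\<lambda>z. ennreal (norm (f z) powr p) * indicator \<Omega> z) \<in> borel_measurable borel"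
proof -
  have [measurable]: "(\<lambda>x. indicator \<Omega> x *\<^sub>R f x) \<in> borel_measurable borel"
    by (intro borel_measurable_continuous_on_indicator holomorphic_n_continuous_on assms)
       (use assms in simp)
  have "(\<lambda>x. ennreal (norm (indicator \<Omega> x *\<^sub>R f x) powr p)) \<in> borel_measurable borel"
    by measurable
  then show ?thesis
    by (rule measurable_cong[THEN iffD1, rotated]) (auto simp: indicator_def)
qed

lemma Lp_int_eq_lborel:
  assumes "open \<Omega>" "holomorphic_n f \<Omega>"
  shows "Lp_int p \<Omega> f = (\<integral>\<^sup>+z\<in>\<Omega>. ennreal (norm (f z) powr p) \<partial>lborel)"
  unfolding Lp_int_def
  by (rule nn_integral_completion)

lemma Lp_int_cmult:
  assumes "open \<Omega>" "holomorphic_n f \<Omega>"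
  shows "Lp_int p \<Omega> (\<lambda>z. c * f z) = ennreal (norm c powr p) * Lp_int p \<Omega> f"
proof -
  have "(\<integral>\<^sup>+z\<in>\<Omega>. ennreal (norm (c * f z) powr p) \<partial>lborel)
    = (\<integral>\<^sup>+z. ennreal (norm c powr p) * (ennreal (norm (f z) powr p) * indicator \<Omega> z) \<partial>lborel)"
    by (intro nn_integral_cong) (simp add: norm_mult powr_mult ennreal_mult mult.assoc)
  also have "\<dots> = ennreal (norm c powr p) * (\<integral>\<^sup>+z\<in>\<Omega>. ennreal (norm (f z) powr p) \<partial>lborel)"
    by (intro nn_integral_cmult) (use borel_measurable_holomorphic_powr[OF assms] in simp)
  finally show ?thesis
    by (simp add: Lp_int_eq_lborel assms holomorphic_n_cmult)
qed

text \<open>Compare \<open>a + b\<close> with twice the maximum. The constant is not sharp; the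
  thresholds in the gliding hump are chosen large enough to absorb it.\<close>

lemma add_powr_le:
  fixes a b :: real
  assumes "0 \<le> a" "0 \<le> b" "0 \<le> q"
  shows "(a + b) powr q \<le> 2 powr q * (a powr q + b powr q)"
proof -
  have "(a + b) powr q \<le> (2 * max a b) powr q"
    using assms by (intro powr_mono2) auto
  also have "\<dots> = 2 powr q * max a b powr q"
    using assms by (simp add: powr_mult)
  also have "\<dots> \<le> 2 powr q * (a powr q + b powr q)"
    by (intro mult_left_mono) (auto simp: max_def)
  finally show ?thesis .
qed

lemma Lp_int_diff_le:
  assumes "open \<Omega>" "holomorphic_n f \<Omega>" "holomorphic_n g \<Omega>" "0 \<le> q"
  shows "Lp_int q \<Omega> (\<lambda>z. f z - g z) \<le> ennreal (2 powr q) * (Lp_int q \<Omega> f + Lp_int q \<Omega> g)"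
proof -
  have [measurable]: "(\<lambda>z. ennreal (norm (f z) powr q) * indicator \<Omega> z) \<in> borel_measurable lborel"
     "(\<lambda>z. ennreal (norm (g z) powr q) * indicator \<Omega> z) \<in> borel_measurable lborel"
    using borel_measurable_holomorphic_powr[OF assms(1,2)]
      borel_measurable_holomorphic_powr[OF assms(1,3)] by simp_all
  have "(\<integral>\<^sup>+z\<in>\<Omega>. ennreal (norm (f z - g z) powr q) \<partial>lborel)
    \<le> (\<integral>\<^sup>+z. ennreal (2 powr q) * (ennreal (norm (f z) powr q) * indicator \<Omega> z
          + ennreal (norm (g z) powr q) * indicator \<Omega> z) \<partial>lborel)"
  proof (rule nn_integral_mono)
    fix z
    have "norm (f z - g z) powr q \<le> (norm (f z) + norm (g z)) powr q"
      using assms by (intro powr_mono2 norm_triangle_ineq4) auto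
    also have "\<dots> \<le> 2 powr q * (norm (f z) powr q + norm (g z) powr q)"
      using assms by (intro add_powr_le) auto
    finally show "ennreal (norm (f z - g z) powr q) * indicator \<Omega> z
      \<le> ennreal (2 powr q) * (ennreal (norm (f z) powr q) * indicator \<Omega> z
          + ennreal (norm (g z) powr q) * indicator \<Omega> z)"
      by (auto simp: indicator_def ennreal_mult[symmetric] simp flip: ennreal_plus intro!: ennreal_leI)
  qed
  also have "\<dots> = ennreal (2 powr q) * ((\<integral>\<^sup>+z\<in>\<Omega>. ennreal (norm (f z) powr q) \<partial>lborel)
      + (\<integral>\<^sup>+z\<in>\<Omega>. ennreal (norm (g z) powr q) \<partial>lborel))"
    by (simp add: nn_integral_cmult nn_integral_add)
  finally show ?thesis
    by (simp add: Lp_int_eq_lborel assms holomorphic_n_diff)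
qed

text \<open>The elementary inequality \<open>t \<le> 1 + t powr p\<close> takes the place of
  Hoelder's inequality: the integral of the modulus over the ball is at most its volume plus the
  p-integral, and the mean value inequality divides this by the volume. The argument is not
  homogeneous in f, hence the normalisation to 1.\<close>

lemma Bergman_point_bound_unit:
  fixes f :: "complex^'n \<Rightarrow> complex"
  assumes "open \<Omega>" "holomorphic_n f \<Omega>" "1 \<le> p" "Lp_int p \<Omega> f \<le> 1" "ball x r \<subseteq> \<Omega>" "0 < r"
  shows "norm (f x) \<le> 1 + 1 / measure lborel (ball (0::complex^'n) r)"
proof -
  let ?V = "measure lborel (ball (0::complex^'n) r)"
  have V: "?V > 0" using assms by (simp add: content_ball_pos)
  have eV: "emeasure lborel (ball y r) = ennreal ?V" for y :: "complex^'n"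
  proof -
    have "emeasure lborel (ball y r) = ennreal (measure lborel (ball y r))"
      by (rule emeasure_eq_ennreal_measure) (use emeasure_lborel_ball_finite[of y r] in auto)
    also have "measure lborel (ball y r) = ?V"
      using assms by (simp add: content_ball)
    finally show ?thesis .
  qed
  have [measurable]: "(\<lambda>z. ennreal (norm (f z) powr p) * indicator \<Omega> z) \<in> borel_measurable lborel"
    "(indicator (ball x r) :: complex^'n \<Rightarrow> ennreal) \<in> borel_measurable borel"
    using borel_measurable_holomorphic_powr[OF assms(1,2)] by (simp_all add: borel_measurable_indicator)
  have "ennreal (norm (f x)) * ennreal ?V \<le> (\<integral>\<^sup>+z\<in>ball x r. ennreal (norm (f z)) \<partial>lborel)"
    using holomorphic_n_mean_ball_le[OF holomorphic_n_subset[OF assms(2,5)]] eV by simp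
  also have "\<dots> \<le> (\<integral>\<^sup>+z. indicator (ball x r) z + ennreal (norm (f z) powr p) * indicator \<Omega> z \<partial>lborel)"
  proof (rule nn_integral_mono)
    fix z
    have "t \<le> 1 + t powr p" if "0 \<le> t" for t :: real
    proof (cases "t \<le> 1")
      case False
      then show ?thesis
        using powr_mono[of 1 p t] assms by simp
    qed (simp add: add_increasing2)
    from this[of "norm (f z)"]
    have "ennreal (norm (f z)) \<le> 1 + ennreal (norm (f z) powr p)"
      by (simp flip: ennreal_plus ennreal_1)
    then show "ennreal (norm (f z)) * indicator (ball x r) z
        \<le> indicator (ball x r) z + ennreal (norm (f z) powr p) * indicator \<Omega> z"
      using assms(5) by (auto simp: indicator_def)
  qed
  also have "\<dots> = ennreal ?V + Lp_int p \<Omega> f"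
    by (subst nn_integral_add) (use assms in \<open>auto simp: eV Lp_int_eq_lborel\<close>)
  also have "\<dots> \<le> ennreal ?V + 1"
    using assms by (intro add_left_mono)
  finally have "ennreal (norm (f x) * ?V) \<le> ennreal (?V + 1)"
    using V by (simp add: ennreal_mult)
  then have "norm (f x) * ?V \<le> ?V + 1"
    using V by (subst (asm) ennreal_le_iff) auto
  then show ?thesis
    using V by (simp add: field_simps)
qed

text \<open>Homogeneity is restored by applying the normalised bound to f / s. Here s is any
  positive upper bound for the p-norm, not the norm itself: this avoids dividing by a vanishing norm
  and allows s to tend to 0 in later arguments.\<close>

lemma Bergman_point_bound:
  fixes f :: "complex^'n \<Rightarrow> complex"
  assumes "open \<Omega>" "holomorphic_n f \<Omega>" "1 \<le> p" "Lp_int p \<Omega> f \<le> ennreal (s powr p)" "0 < s"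
    "ball x r \<subseteq> \<Omega>" "0 < r"
  shows "norm (f x) \<le> s * (1 + 1 / measure lborel (ball (0::complex^'n) r))"
proof -
  have "Lp_int p \<Omega> (\<lambda>z. complex_of_real (1/s) * f z) = ennreal ((1/s) powr p) * Lp_int p \<Omega> f"
    using Lp_int_cmult[OF assms(1,2), of p "complex_of_real (1/s)"] assms(5) by (simp only: norm_of_real) simp
  also have "\<dots> \<le> ennreal ((1/s) powr p) * ennreal (s powr p)"
    using assms by (intro mult_left_mono) auto
  also have "\<dots> = ennreal (((1/s) * s) powr p)"
    by (simp only: ennreal_mult[symmetric] powr_ge_zero powr_mult)
  also have "\<dots> = 1"
    using assms by simp
  finally have "norm (complex_of_real (1/s) * f x) \<le> 1 + 1 / measure lborel (ball (0::complex^'n) r)"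
    by (intro Bergman_point_bound_unit[OF assms(1) holomorphic_n_cmult[OF assms(2)] assms(3) _ assms(6,7)])
  then show ?thesis
    using assms by (simp add: norm_mult norm_divide field_simps)
qed

text \<open>The derivative in direction h is the ordinary derivative at 0 of the restriction to the
  complex line through x along h, where the one-variable Cauchy inequality applies.\<close>

lemma holomorphic_n_derivative_bound:
  fixes f :: "complex^'n \<Rightarrow> complex"
  assumes f: "holomorphic_n f (ball x r)" and B: "\<And>y. y \<in> ball x r \<Longrightarrow> norm (f y) \<le> B"
    and "0 < r" and D: "(f has_derivative (\<lambda>h. \<Sum>i\<in>UNIV. c$i * h$i)) (at x)"
  shows "norm (\<Sum>i\<in>UNIV. c$i * h$i) \<le> 2 * B / r * norm h"
proof (cases "h = 0")
  case False
  \<comment> \<open>A parameter disc of this radius is mapped into the points at distance at most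
    r/2 from x, so the closed disc stays inside the open ball. This halving is the origin of the
    factor 2 in the bound.\<close>
  define \<rho> where "\<rho> = r / (2 * norm h)"
  have \<rho>: "\<rho> > 0" using False assms by (simp add: \<rho>_def)
  have inball: "x + \<zeta> *s h \<in> ball x r" if "\<zeta> \<in> cball 0 \<rho>" for \<zeta>
  proof -
    have "norm (\<zeta> *s h) \<le> \<rho> * norm h"
      unfolding norm_vector_scalar_mult using that by (intro mult_right_mono) auto
    also have "\<dots> < r" using False assms by (simp add: \<rho>_def)
    finally show ?thesis by (simp add: dist_norm)
  qed
  let ?g = "\<lambda>\<zeta>. f (x + \<zeta> *s h)"
  have hol: "?g holomorphic_on cball 0 \<rho>"
    by (rule slice_holomorphic[OF f inball])
  have "norm ((deriv ^^ 1) ?g 0) \<le> fact 1 * B / \<rho> ^ 1"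
  proof (rule Cauchy_inequality)
    show "?g holomorphic_on ball 0 \<rho>"
      using hol by (rule holomorphic_on_subset) auto
    show "continuous_on (cball 0 \<rho>) ?g"
      using hol by (rule holomorphic_on_imp_continuous_on)
    show "norm (?g \<zeta>) \<le> B" if "norm (0 - \<zeta>) = \<rho>" for \<zeta>
      by (rule B, rule inball) (use that in simp)
  qed (rule \<rho>)
  moreover have "(?g has_field_derivative (\<Sum>i\<in>UNIV. c$i * h$i)) (at 0)"
    by (rule slice_has_field_derivative) (use D in simp)
  ultimately have "norm (\<Sum>i\<in>UNIV. c$i * h$i) \<le> B / \<rho>"
    by (simp add: DERIV_imp_deriv)
  also have "\<dots> = 2 * B / r * norm h"
    using False by (simp add: \<rho>_def field_simps)
  finally show ?thesis .
qed auto

text \<open>Points within r of x are still centres of balls of radius r inside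
  \<open>ball x (2 * r)\<close>, so the pointwise bound holds on all of \<open>ball x r\<close> and
  Cauchy's estimate gives the derivative at x. \<open>L\<close> is obtained before f, s and x, and
  this uniformity is what the Lipschitz estimate and the convergence of series rest on.\<close>

lemma Bergman_derivative_bound:
  fixes \<Omega> :: "(complex^'n) set"
  assumes "open \<Omega>" "1 \<le> p" "0 < r"
  obtains L where "0 \<le> L" "\<And>f s x c h. holomorphic_n f \<Omega> \<Longrightarrow> 0 < s \<Longrightarrow> Lp_int p \<Omega> f \<le> ennreal (s powr p)
     \<Longrightarrow> ball x (2 * r) \<subseteq> \<Omega> \<Longrightarrow> (f has_derivative (\<lambda>h. \<Sum>i\<in>UNIV. c$i * h$i)) (at x)
     \<Longrightarrow> norm (\<Sum>i\<in>UNIV. c$i * h$i) \<le> s * L * norm h"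
proof
  let ?M = "1 + 1 / measure lborel (ball (0::complex^'n) r)"
  have "measure lborel (ball (0::complex^'n) r) > 0"
    using assms by (simp add: content_ball_pos)
  then show "0 \<le> 2 * ?M / r" using assms by simp
  fix f s x c h
  assume f: "holomorphic_n f \<Omega>" "0 < s" "Lp_int p \<Omega> f \<le> ennreal (s powr p)"
     "ball x (2 * r) \<subseteq> \<Omega>" "(f has_derivative (\<lambda>h. \<Sum>i\<in>UNIV. c$i * h$i)) (at x)"
  have sub: "ball y r \<subseteq> \<Omega>" if "y \<in> ball x r" for y
  proof -
    have "ball y r \<subseteq> ball x (2 * r)"
      using that by (subst ball_subset_ball_iff) (auto simp: dist_commute)
    then show ?thesis using f(4) by blast
  qed
  have "norm (\<Sum>i\<in>UNIV. c$i * h$i) \<le> 2 * (s * ?M) / r * norm h"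
  proof (rule holomorphic_n_derivative_bound[OF _ _ assms(3) f(5)])
    show "holomorphic_n f (ball x r)"
      by (rule holomorphic_n_subset[OF f(1) sub]) (use assms in simp)
    show "norm (f y) \<le> s * ?M" if "y \<in> ball x r" for y
      by (rule Bergman_point_bound[OF assms(1) f(1) assms(2) f(3,2) sub[OF that] assms(3)])
  qed
  then show "norm (\<Sum>i\<in>UNIV. c$i * h$i) \<le> s * (2 * ?M / r) * norm h"
    by (simp add: mult_ac)
qed

text \<open>Integrate the derivative bound along segments in the convex ball. The radius 3r is the
  room needed: each point within r of x must itself have a ball of radius 2r inside
  \<open>\<Omega>\<close>.\<close>

lemma Bergman_Lipschitz:
  fixes \<Omega> :: "(complex^'n) set"
  assumes "open \<Omega>" "1 \<le> p" "0 < r"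
  obtains L where "0 \<le> L" "\<And>f x y. holomorphic_n f \<Omega> \<Longrightarrow> Lp_int p \<Omega> f \<le> 1
     \<Longrightarrow> ball x (3 * r) \<subseteq> \<Omega> \<Longrightarrow> y \<in> ball x r \<Longrightarrow> norm (f y - f x) \<le> L * norm (y - x)"
proof -
  obtain L where L: "0 \<le> L" "\<And>f s x c h. holomorphic_n f \<Omega> \<Longrightarrow> 0 < s \<Longrightarrow> Lp_int p \<Omega> f \<le> ennreal (s powr p)
     \<Longrightarrow> ball x (2 * r) \<subseteq> \<Omega> \<Longrightarrow> (f has_derivative (\<lambda>h. \<Sum>i\<in>UNIV. c$i * h$i)) (at x)
     \<Longrightarrow> norm (\<Sum>i\<in>UNIV. c$i * h$i) \<le> s * L * norm h"
    using Bergman_derivative_bound[OF assms] by blast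
  show thesis
  proof
    fix f x y
    assume f: "holomorphic_n f \<Omega>" "Lp_int p \<Omega> f \<le> 1" "ball x (3 * r) \<subseteq> \<Omega>" "y \<in> ball x r"
    have sub: "ball z (2 * r) \<subseteq> \<Omega>" if "z \<in> ball x r" for z
    proof -
      have "ball z (2 * r) \<subseteq> ball x (3 * r)"
        using that by (subst ball_subset_ball_iff) (auto simp: dist_commute)
      then show ?thesis using f(3) by blast
    qed
    have "\<forall>z\<in>\<Omega>. \<exists>c::complex^'n. (f has_derivative (\<lambda>h. \<Sum>i\<in>UNIV. c$i * h$i)) (at z)"
      using f(1) unfolding holomorphic_n_def .
    then obtain c where c: "\<And>z. z \<in> \<Omega> \<Longrightarrow> (f has_derivative (\<lambda>h. \<Sum>i\<in>UNIV. c z$i * h$i)) (at z)"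
      by metis
    have in\<Omega>: "z \<in> \<Omega>" if "z \<in> ball x r" for z
      using sub[OF that] assms by (meson centre_in_ball mult_pos_pos subsetD zero_less_numeral)
    show "norm (f y - f x) \<le> L * norm (y - x)"
    proof (rule differentiable_bound[where S = "ball x r" and f' = "\<lambda>z h. \<Sum>i\<in>UNIV. c z$i * h$i"])
      fix z assume z: "z \<in> ball x r"
      show "(f has_derivative (\<lambda>h. \<Sum>i\<in>UNIV. c z$i * h$i)) (at z within ball x r)"
        using c[OF in\<Omega>[OF z]] by (rule has_derivative_at_withinI)
      show "onorm (\<lambda>h. \<Sum>i\<in>UNIV. c z$i * h$i) \<le> L"
      proof (rule onorm_le)
        fix h
        show "norm (\<Sum>i\<in>UNIV. c z$i * h$i) \<le> L * norm h"
          using L(2)[of f 1 z "c z" h] f z c[OF in\<Omega>[OF z]] sub[OF z] by simp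
      qed
    qed (use f assms in auto)
  qed (rule L)
qed

section \<open>Series with geometric bounds\<close>

lemma geometric_tail_bound:
  fixes a :: "nat \<Rightarrow> 'a::banach"
  assumes "\<And>k. norm (a k) \<le> B * (1/2) ^ Suc k"
  shows "summable a" "norm ((\<Sum>k<n. a k) - suminf a) \<le> B * (1/2) ^ n"
proof -
  have s: "summable (\<lambda>k. B * (1/2) ^ Suc k :: real)"
    using summable_mult[OF summable_geometric[of "1/2::real"], of "B * (1/2)"] by (simp add: mult_ac)
  have sn: "summable (\<lambda>k. norm (a k))"
    by (rule summable_comparison_test'[OF s, of 0]) (use assms in auto)
  then show sa: "summable a"
    by (rule summable_norm_cancel)
  have "norm ((\<Sum>k<n. a k) - suminf a) = norm (\<Sum>k. a (k + n))"
    using suminf_minus_initial_segment[OF sa, of n] by (simp add: norm_minus_commute)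
  also have "\<dots> \<le> (\<Sum>k. norm (a (k + n)))"
    by (rule summable_norm) (rule summable_ignore_initial_segment[OF sn])
  also have "\<dots> \<le> (\<Sum>k. B * (1/2) ^ Suc (k + n))"
    by (rule suminf_le[OF assms summable_ignore_initial_segment[OF sn] summable_ignore_initial_segment[OF s]])
  also have "\<dots> = (\<Sum>k. (B * (1/2) ^ Suc n) * (1/2) ^ k)"
    by (simp add: power_add mult_ac)
  also have "\<dots> = (B * (1/2) ^ Suc n) * (\<Sum>k. (1/2) ^ k)"
    by (rule suminf_mult) (simp add: summable_geometric)
  also have "\<dots> = B * (1/2) ^ n"
    by (subst suminf_geometric) auto
  finally show "norm ((\<Sum>k<n. a k) - suminf a) \<le> B * (1/2) ^ n" .
qed

text \<open>Replaces Minkowski's inequality: if each term is at most \<open>2 ^ - Suc k\<close> times a common bound,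
  then so is the sum, and the supremum of the rescaled terms is bounded by the series of their powers.\<close>

lemma norm_suminf_powr_le:
  fixes b :: "nat \<Rightarrow> 'a::banach"
  assumes "0 < p"
  shows "ennreal (norm (suminf b) powr p) \<le> (\<Sum>k. ennreal ((2 ^ Suc k * norm (b k)) powr p))"
proof (cases "(\<Sum>k. ennreal ((2 ^ Suc k * norm (b k)) powr p))")
  case (real t)
  have "norm (b k) \<le> t powr (1/p) * (1/2) ^ Suc k" for k
  proof -
    have "ennreal ((2 ^ Suc k * norm (b k)) powr p) \<le> ennreal t"
      using sum_le_suminf[of "\<lambda>k. ennreal ((2 ^ Suc k * norm (b k)) powr p)" "{k}"]
      by (simp only: real(2) sum.insert sum.empty finite.intros empty_iff add_0_right summableI finite_insert zero_le simp_thms)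
    then have "(2 ^ Suc k * norm (b k)) powr p \<le> t"
      using real by simp
    then have "((2 ^ Suc k * norm (b k)) powr p) powr (1/p) \<le> t powr (1/p)"
      using assms by (intro powr_mono2) auto
    then have "2 ^ Suc k * norm (b k) \<le> t powr (1/p)"
      using assms by (simp add: powr_powr)
    then show ?thesis
      by (simp add: field_simps)
  qed
  from geometric_tail_bound(2)[OF this, of 0]
  have "norm (suminf b) \<le> t powr (1/p)" by simp
  then have "norm (suminf b) powr p \<le> (t powr (1/p)) powr p"
    using assms by (intro powr_mono2) auto
  also have "\<dots> = t" using assms real by (simp add: powr_powr)
  finally show ?thesis using real by (simp add: ennreal_leI)
qed simp

subsection \<open>Completeness and semicontinuity\<close>

text \<open>A Weierstrass theorem: the derivative bound makes the differentiated series converge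
  uniformly on \<open>ball z r\<close>, relative to the norm of h, so termwise differentiation is
  legitimate. The point to watch is that the limit derivative must again be complex linear, that is,
  given by a coefficient vector \<open>C x\<close>.\<close>

lemma Bergman_series_local:
  fixes f :: "nat \<Rightarrow> complex^'n \<Rightarrow> complex"
  assumes "open \<Omega>" "1 \<le> p" "0 < r" and sub: "ball z (3 * r) \<subseteq> \<Omega>"
    and hol: "\<And>k. holomorphic_n (f k) \<Omega>"
    and small: "\<And>k. Lp_int p \<Omega> (f k) \<le> ennreal (((1/2) ^ Suc k) powr p)"
  shows "summable (\<lambda>k. f k z)"
    and "\<exists>c. ((\<lambda>z. \<Sum>k. f k z) has_derivative (\<lambda>h. \<Sum>i\<in>UNIV. c$i * h$i)) (at z)"
proof -
  have sub2: "ball x (2 * r) \<subseteq> \<Omega>" if "x \<in> ball z r" for x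
  proof -
    have "ball x (2 * r) \<subseteq> ball z (3 * r)"
      using that by (subst ball_subset_ball_iff) (auto simp: dist_commute)
    then show ?thesis using sub by blast
  qed
  have in\<Omega>: "x \<in> \<Omega>" if "x \<in> ball z r" for x
    using sub2[OF that] assms by (meson centre_in_ball mult_pos_pos subsetD zero_less_numeral)
  have zin: "z \<in> ball z r" using assms by simp
  have "ball z r \<subseteq> \<Omega>" using in\<Omega> by blast
  then have "norm (f k z) \<le> (1/2) ^ Suc k * (1 + 1 / measure lborel (ball (0::complex^'n) r))" for k
    by (rule Bergman_point_bound[OF assms(1) hol assms(2) small, rotated]) (use assms in auto)
  then show sz: "summable (\<lambda>k. f k z)"
    by (intro geometric_tail_bound(1)[where B = "1 + 1 / measure lborel (ball (0::complex^'n) r)"])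
       (simp only: mult.commute)
  obtain L where L: "0 \<le> L" "\<And>f s x c h. holomorphic_n f \<Omega> \<Longrightarrow> 0 < s \<Longrightarrow> Lp_int p \<Omega> f \<le> ennreal (s powr p)
     \<Longrightarrow> ball x (2 * r) \<subseteq> \<Omega> \<Longrightarrow> (f has_derivative (\<lambda>h. \<Sum>i\<in>UNIV. c$i * h$i)) (at x)
     \<Longrightarrow> norm (\<Sum>i\<in>UNIV. c$i * h$i) \<le> s * L * norm h"
    using Bergman_derivative_bound[OF assms(1-3)] by blast
  have "\<forall>k. \<forall>z\<in>\<Omega>. \<exists>c. (f k has_derivative (\<lambda>h. \<Sum>i\<in>UNIV. c$i * h$i)) (at z)"
    using hol unfolding holomorphic_n_def by blast
  then obtain c where c: "\<And>k x. x \<in> \<Omega> \<Longrightarrow> (f k has_derivative (\<lambda>h. \<Sum>i\<in>UNIV. c k x$i * h$i)) (at x)"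
    by metis
  define D where "D k x h = (\<Sum>i\<in>UNIV. c k x$i * h$i)" for k x h
  define C where "C x = (\<chi> i. \<Sum>k. c k x $ i)" for x
  have D: "norm (D k x h) \<le> L * norm h * (1/2) ^ Suc k" if "x \<in> ball z r" for k x h
    using L(2)[OF hol _ small sub2[OF that] c[OF in\<Omega>[OF that]], of k h]
    unfolding D_def by (simp add: mult_ac)
  have C: "(\<Sum>k. D k x h) = (\<Sum>i\<in>UNIV. C x $ i * h $ i)" if "x \<in> ball z r" for x h
  proof -
    \<comment> \<open>Testing the derivatives on the standard basis reads off their coefficients, so
      the geometric bound on the derivatives makes each coefficient series summable.\<close>
    have "D k x (axis i 1) = c k x $ i" for k i
      unfolding D_def by (simp add: axis_def if_distrib cong: if_cong)
    then have sc: "summable (\<lambda>k. c k x $ i)" for i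
      using geometric_tail_bound(1)[OF D[OF that, of _ "axis i 1"]] by simp
    then have "(\<Sum>k. D k x h) = (\<Sum>i\<in>UNIV. \<Sum>k. c k x $ i * h $ i)"
      unfolding D_def by (intro suminf_sum summable_mult2)
    also have "\<dots> = (\<Sum>i\<in>UNIV. C x $ i * h $ i)"
      unfolding C_def by (intro sum.cong refl) (simp add: suminf_mult2[OF sc])
    finally show ?thesis .
  qed
  have "\<exists>g. \<forall>x\<in>ball z r. (\<lambda>k. f k x) sums (g x) \<and> (g has_derivative (\<lambda>h. \<Sum>i\<in>UNIV. C x $ i * h $ i)) (at x within ball z r)"
  proof (rule has_derivative_series[OF convex_ball])
    show "(f k has_derivative D k x) (at x within ball z r)" if "x \<in> ball z r" for k x
      using has_derivative_at_withinI[OF c[OF in\<Omega>[OF that]]] unfolding D_def .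
    show "\<forall>\<^sub>F n in sequentially. \<forall>x\<in>ball z r. \<forall>h. 
        norm ((\<Sum>k<n. D k x h) - (\<Sum>i\<in>UNIV. C x $ i * h $ i)) \<le> e * norm h" if "0 < e" for e
    proof -
      have "(\<lambda>n. L * (1/2) ^ n) \<longlonglongrightarrow> L * 0"
        by (intro tendsto_intros LIMSEQ_power_zero) simp
      then have "\<forall>\<^sub>F n in sequentially. L * (1/2) ^ n < e"
        using that by (auto dest: order_tendstoD)
      then show ?thesis
      proof eventually_elim
        case (elim n)
        show ?case
        proof (intro ballI allI)
          fix x h assume x: "x \<in> ball z r"
          have "norm ((\<Sum>k<n. D k x h) - (\<Sum>i\<in>UNIV. C x $ i * h $ i)) \<le> L * norm h * (1/2) ^ n"
            unfolding C[OF x, symmetric] by (rule geometric_tail_bound(2)) (rule D[OF x])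
          also have "\<dots> = (L * (1/2) ^ n) * norm h" by simp
          also have "\<dots> \<le> e * norm h" 
            by (rule mult_right_mono) (use elim in auto)
          finally show "norm ((\<Sum>k<n. D k x h) - (\<Sum>i\<in>UNIV. C x $ i * h $ i)) \<le> e * norm h" .
        qed
      qed
    qed
    show "z \<in> ball z r" by (rule zin)
    show "(\<lambda>k. f k z) sums (\<Sum>k. f k z)" using sz by (rule summable_sums)
  qed
  then obtain g where g: "\<And>x. x \<in> ball z r \<Longrightarrow> (\<lambda>k. f k x) sums (g x)"
      "(g has_derivative (\<lambda>h. \<Sum>i\<in>UNIV. C z $ i * h $ i)) (at z within ball z r)"
    using zin by blast
  have "(g has_derivative (\<lambda>h. \<Sum>i\<in>UNIV. C z $ i * h $ i)) (at z)"
    using g(2) at_within_open[OF zin open_ball] by simp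
  then have "((\<lambda>z. \<Sum>k. f k z) has_derivative (\<lambda>h. \<Sum>i\<in>UNIV. C z $ i * h $ i)) (at z)"
    by (rule has_derivative_transform_within_open[OF _ open_ball zin]) (use g(1) sums_unique in blast)
  then show "\<exists>c. ((\<lambda>z. \<Sum>k. f k z) has_derivative (\<lambda>h. \<Sum>i\<in>UNIV. c$i * h$i)) (at z)"
    by blast
qed

text \<open>Each factor in the smallness hypothesis has its task. The p-th power of
  \<open>(1/2) ^ Suc k\<close> offsets the weights in \<open>norm_suminf_powr_le\<close>, the next
  \<open>(1/2) ^ Suc k\<close> makes the integrals summable, and \<open>\<epsilon> k\<close>
  survives in the tail: since \<open>\<epsilon>\<close> decreases, the error after n terms stays
  below the tolerance fixed at stage n. The gliding hump needs exactly this.\<close>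

lemma Bergman_series:
  fixes f :: "nat \<Rightarrow> complex^'n \<Rightarrow> complex"
  assumes "open \<Omega>" "1 \<le> p"
    and hol: "\<And>k. holomorphic_n (f k) \<Omega>"
    and eps: "decseq \<epsilon>" "\<And>k. 0 \<le> \<epsilon> k" "\<epsilon> 0 \<le> 1"
    and small: "\<And>k. Lp_int p \<Omega> (f k) \<le> ennreal (((1/2) ^ Suc k) powr p * ((1/2) ^ Suc k * \<epsilon> k))"
  shows "holomorphic_n (\<lambda>z. \<Sum>k. f k z) \<Omega>"
    and "Lp_int p \<Omega> (\<lambda>z. (\<Sum>k<n. f k z) - (\<Sum>k. f k z)) \<le> ennreal (\<epsilon> n * (1/2) ^ n)"
proof -
  have small': "Lp_int p \<Omega> (f k) \<le> ennreal (((1/2) ^ Suc k) powr p)" for k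
  proof -
    have "(1/2::real) ^ Suc k \<le> 1" by (intro power_le_one) auto
    moreover have "\<epsilon> k \<le> 1"
      using eps(1,3) unfolding decseq_def by (meson order_trans zero_le)
    ultimately have "(1/2) ^ Suc k * \<epsilon> k \<le> 1"
      using eps(2)[of k] by (simp add: mult_le_one del: power_Suc)
    then have "((1/2) ^ Suc k) powr p * ((1/2) ^ Suc k * \<epsilon> k) \<le> ((1/2) ^ Suc k) powr p"
      by (intro mult_left_le) auto
    then show ?thesis using small[of k] by (meson order_trans ennreal_leI)
  qed
  have loc: "summable (\<lambda>k. f k z) \<and> (\<exists>c. ((\<lambda>z. \<Sum>k. f k z) has_derivative (\<lambda>h. \<Sum>i\<in>UNIV. c$i * h$i)) (at z))"
    if z: "z \<in> \<Omega>" for z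
  proof -
    obtain R where R: "0 < R" "ball z R \<subseteq> \<Omega>"
      using assms(1) z openE by blast
    have "0 < R / 3" "ball z (3 * (R / 3)) \<subseteq> \<Omega>" using R by auto
    from Bergman_series_local[OF assms(1,2) this hol small'] show ?thesis by blast
  qed
  then show hs: "holomorphic_n (\<lambda>z. \<Sum>k. f k z) \<Omega>"
    unfolding holomorphic_n_def by blast
  have hsum: "holomorphic_n (\<lambda>z. \<Sum>k<n. f k z) \<Omega>" for n
    by (induction n) (auto intro: holomorphic_n_add hol holomorphic_n_cmult[OF hol, of 0 0, simplified])
  have meas: "(\<lambda>z. ennreal (norm (f k z) powr p) * indicator \<Omega> z) \<in> borel_measurable lborel" for k
    using borel_measurable_holomorphic_powr[OF assms(1) hol] by simp
  have "Lp_int p \<Omega> (\<lambda>z. (\<Sum>k<n. f k z) - (\<Sum>k. f k z))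
     = (\<integral>\<^sup>+z\<in>\<Omega>. ennreal (norm ((\<Sum>k<n. f k z) - (\<Sum>k. f k z)) powr p) \<partial>lborel)"
    by (intro Lp_int_eq_lborel assms holomorphic_n_diff hs hsum)
  also have "\<dots> \<le> (\<integral>\<^sup>+z. (\<Sum>k. ennreal ((2 ^ Suc k) powr p) * (ennreal (norm (f (k + n) z) powr p) * indicator \<Omega> z)) \<partial>lborel)"
  proof (rule nn_integral_mono)
    fix z
    have "ennreal (norm ((\<Sum>k<n. f k z) - (\<Sum>k. f k z)) powr p)
       \<le> (\<Sum>k. ennreal ((2 ^ Suc k) powr p) * ennreal (norm (f (k + n) z) powr p))" if "z \<in> \<Omega>"
    proof -
      have "(\<Sum>k. f (k + n) z) = (\<Sum>k. f k z) - (\<Sum>k<n. f k z)"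
        using loc[OF that] by (intro suminf_minus_initial_segment) blast
      then have "ennreal (norm ((\<Sum>k<n. f k z) - (\<Sum>k. f k z)) powr p)
          = ennreal (norm (\<Sum>k. f (k + n) z) powr p)"
        by (simp add: norm_minus_commute)
      also have "\<dots> \<le> (\<Sum>k. ennreal ((2 ^ Suc k * norm (f (k + n) z)) powr p))"
        by (rule norm_suminf_powr_le) (use assms in simp)
      also have "\<dots> = (\<Sum>k. ennreal ((2 ^ Suc k) powr p) * ennreal (norm (f (k + n) z) powr p))"
        by (simp only: powr_mult ennreal_mult[OF powr_ge_zero powr_ge_zero])
      finally show ?thesis .
    qed
    then show "ennreal (norm ((\<Sum>k<n. f k z) - (\<Sum>k. f k z)) powr p) * indicator \<Omega> z
       \<le> (\<Sum>k. ennreal ((2 ^ Suc k) powr p) * (ennreal (norm (f (k + n) z) powr p) * indicator \<Omega> z))"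
      by (cases "z \<in> \<Omega>") simp_all
  qed
  also have "\<dots> = (\<Sum>k. \<integral>\<^sup>+z. ennreal ((2 ^ Suc k) powr p) * (ennreal (norm (f (k + n) z) powr p) * indicator \<Omega> z) \<partial>lborel)"
    by (rule nn_integral_suminf) (intro borel_measurable_times_ennreal borel_measurable_const meas)
  also have "\<dots> = (\<Sum>k. ennreal ((2 ^ Suc k) powr p) * Lp_int p \<Omega> (f (k + n)))"
    by (simp only: nn_integral_cmult[OF meas] Lp_int_eq_lborel[OF assms(1) hol])
  also have "\<dots> \<le> (\<Sum>k. ennreal (\<epsilon> n * (1/2) ^ n * (1/2) ^ Suc k))"
  proof (intro suminf_le summableI)
    fix k
    have "ennreal ((2 ^ Suc k) powr p) * Lp_int p \<Omega> (f (k + n))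
       \<le> ennreal ((2 ^ Suc k) powr p) * ennreal (((1/2) ^ Suc (k + n)) powr p * ((1/2) ^ Suc (k + n) * \<epsilon> (k + n)))"
      by (intro mult_left_mono small) simp
    also have "\<dots> = ennreal ((2 ^ Suc k * (1/2) ^ Suc (k + n)) powr p * ((1/2) ^ Suc (k + n) * \<epsilon> (k + n)))"
      by (subst ennreal_mult[symmetric]) (use eps(2) in \<open>simp_all only: powr_mult mult.assoc, auto\<close>)
    also have "2 ^ Suc k * (1/2) ^ Suc (k + n) = (1/2::real) ^ n"
      by (simp add: power_add power_one_over)
    also have "ennreal (((1/2) ^ n) powr p * ((1/2) ^ Suc (k + n) * \<epsilon> (k + n)))
       \<le> ennreal (1 * ((1/2) ^ Suc (k + n) * \<epsilon> n))"
    proof (intro ennreal_leI mult_mono mult_left_mono)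
      show "((1/2::real) ^ n) powr p \<le> 1"
        using assms power_le_one[of "1/2::real" n] by (intro powr_le1) auto
      show "\<epsilon> (k + n) \<le> \<epsilon> n"
        using eps(1) by (simp add: decseq_def)
    qed (use eps(2) in auto)
    also have "1 * ((1/2) ^ Suc (k + n) * \<epsilon> n) = \<epsilon> n * (1/2) ^ n * (1/2) ^ Suc k"
      by (simp add: power_add mult_ac)
    finally show "ennreal ((2 ^ Suc k) powr p) * Lp_int p \<Omega> (f (k + n)) \<le> ennreal (\<epsilon> n * (1/2) ^ n * (1/2) ^ Suc k)" .
  qed
  also have "\<dots> = ennreal (\<epsilon> n * (1/2) ^ n)"
  proof (rule suminf_ennreal_eq)
    show "(\<lambda>k. \<epsilon> n * (1/2) ^ n * (1/2) ^ Suc k) sums (\<epsilon> n * (1/2) ^ n)"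
      using sums_mult[OF power_half_series, of "\<epsilon> n * (1/2) ^ n"] by simp
  qed (use eps(2) in auto)
  finally show "Lp_int p \<Omega> (\<lambda>z. (\<Sum>k<n. f k z) - (\<Sum>k. f k z)) \<le> ennreal (\<epsilon> n * (1/2) ^ n)" .
qed

text \<open>Closeness is measured with exponent p, while the functional has exponent q. Pointwise
  convergence links them: p-convergence implies it through the Bergman bound with s = 1/(j+1), and
  Fatou's lemma then applies to the q-integrals.\<close>

lemma Lp_int_lower_semicontinuous:
  fixes g :: "complex^'n \<Rightarrow> complex"
  assumes "open \<Omega>" "1 \<le> p" "0 < q" "holomorphic_n g \<Omega>" "M < Lp_int q \<Omega> g"
  shows "\<exists>\<delta>>0. \<forall>h. holomorphic_n h \<Omega> \<longrightarrow> Lp_int p \<Omega> (\<lambda>z. g z - h z) \<le> ennreal \<delta> \<longrightarrow> M < Lp_int q \<Omega> h"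
proof (rule ccontr)
  assume neg: "\<not> ?thesis"
  have "\<exists>h. holomorphic_n h \<Omega> \<and> Lp_int p \<Omega> (\<lambda>z. g z - h z) \<le> ennreal ((1 / real (Suc j)) powr p)
     \<and> Lp_int q \<Omega> h \<le> M" for j
  proof -
    have "(1 / real (Suc j)) powr p > 0" by simp
    then show ?thesis using neg by (meson not_less)
  qed
  then obtain h where h: "\<And>j. holomorphic_n (h j) \<Omega>"
      "\<And>j. Lp_int p \<Omega> (\<lambda>z. g z - h j z) \<le> ennreal ((1 / real (Suc j)) powr p)"
      "\<And>j. Lp_int q \<Omega> (h j) \<le> M"
    by metis
  have lim: "(\<lambda>j. h j z) \<longlonglongrightarrow> g z" if z: "z \<in> \<Omega>" for z
  proof -
    obtain r where r: "0 < r" "ball z r \<subseteq> \<Omega>"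
      using assms(1) z unfolding open_contains_ball by meson
    let ?M = "1 + 1 / measure lborel (ball (0::complex^'n) r)"
    have le: "norm (g z - h j z) \<le> 1 / real (Suc j) * ?M" for j
      by (rule Bergman_point_bound[OF assms(1) holomorphic_n_diff[OF assms(4) h(1)] assms(2) h(2) _ r(2,1)]) simp
    have "(\<lambda>j. 1 / real (Suc j) * ?M) \<longlonglongrightarrow> 0 * ?M"
      using LIMSEQ_inverse_real_of_nat unfolding inverse_eq_divide by (rule tendsto_mult_right)
    then have "(\<lambda>j. 1 / real (Suc j) * ?M) \<longlonglongrightarrow> 0"
      by (simp only: mult_zero_left)
    then have "(\<lambda>j. g z - h j z) \<longlonglongrightarrow> 0"
      by (rule Lim_null_comparison[rotated]) (rule always_eventually, rule allI, rule le)
    from tendsto_diff[OF tendsto_const[of "g z"] this] show ?thesis by simp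
  qed
  have "Lp_int q \<Omega> g = (\<integral>\<^sup>+z. liminf (\<lambda>j. ennreal (norm (h j z) powr q) * indicator \<Omega> z) \<partial>lborel)"
    unfolding Lp_int_eq_lborel[OF assms(1,4)]
  proof (rule nn_integral_cong)
    fix z
    have "ennreal (norm (g z) powr q) = liminf (\<lambda>j. ennreal (norm (h j z) powr q))" if "z \<in> \<Omega>"
      using lim[OF that] assms(3)
      by (intro lim_imp_Liminf[symmetric] tendsto_ennrealI tendsto_powr2 tendsto_norm tendsto_const) auto
    then show "ennreal (norm (g z) powr q) * indicator \<Omega> z = liminf (\<lambda>j. ennreal (norm (h j z) powr q) * indicator \<Omega> z)"
      by (cases "z \<in> \<Omega>") (simp_all add: Liminf_const)
  qed
  also have "\<dots> \<le> liminf (\<lambda>j. \<integral>\<^sup>+z. ennreal (norm (h j z) powr q) * indicator \<Omega> z \<partial>lborel)"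
    by (rule nn_integral_liminf) (use borel_measurable_holomorphic_powr[OF assms(1) h(1)] in simp)
  also have "\<dots> \<le> liminf (\<lambda>j. M)"
    by (intro Liminf_mono always_eventually allI)
       (use h(3) Lp_int_eq_lborel[OF assms(1) h(1)] in simp)
  also have "\<dots> = M" by (simp add: Liminf_const)
  finally show False using assms(5) by simp
qed

subsection \<open>The a priori inequality\<close>

text \<open>Gliding hump: perturbations with rapidly decreasing p-norm force the q-integral of the partial sums above
  every integer, and lower semicontinuity keeps it there in the limit, which lies in \<open>E\<close>.\<close>

lemma Bergman_uniform_bound:
  fixes \<Omega> :: "(complex^'n) set"
  assumes "open \<Omega>" "1 \<le> p" "0 < q"
    and EB: "E \<subseteq> Bergman (ereal p) \<Omega>" and sub: "complex_subspace E"
    and closed: "Lp_closed_in_Bergman p \<Omega> E"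
    and Eq: "\<And>f. f \<in> E \<Longrightarrow> Lp_int q \<Omega> f < \<infinity>"
  shows "\<exists>C. \<forall>f\<in>E. Lp_int p \<Omega> f \<le> 1 \<longrightarrow> Lp_int q \<Omega> f \<le> ennreal C"
proof (rule ccontr)
  assume neg: "\<not> ?thesis"
  have hol: "holomorphic_n f \<Omega>" if "f \<in> E" for f
    using EB that by (auto simp: Bergman_def)
  have zero: "f z = 0" if "f \<in> E" "z \<notin> \<Omega>" for f z
    using EB that by (auto simp: Bergman_def)
  have E0: "(\<lambda>z. 0) \<in> E" and Eadd: "\<And>f g. f \<in> E \<Longrightarrow> g \<in> E \<Longrightarrow> (\<lambda>z. f z + g z) \<in> E"
    and Ec: "\<And>c f. f \<in> E \<Longrightarrow> (\<lambda>z. c * f z) \<in> E"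
    using sub unfolding complex_subspace_def by auto
  have perturb: "\<exists>f\<in>E. Lp_int p \<Omega> f \<le> ennreal \<eta> \<and> ennreal K < Lp_int q \<Omega> (\<lambda>z. g z + f z)"
    if g: "g \<in> E" and \<eta>: "0 < \<eta>" and K: "0 \<le> K" for g \<eta> K
  proof -
    define s where "s = \<eta> powr (1/p)"
    have s: "s > 0" "s powr p = \<eta>"
      using \<eta> assms by (auto simp: s_def powr_powr)
    obtain G where G: "0 \<le> G" "Lp_int q \<Omega> g = ennreal G"
      using Eq[OF g] by (cases "Lp_int q \<Omega> g") auto
    \<comment> \<open>The threshold is obtained backwards. If the q-integral of g + f were at most
      \<open>K\<close>, that of f = (g + f) - g would be at most \<open>2 powr q * (K + G)\<close>;
      undoing the scaling by s gives the bound that \<open>f0\<close> is chosen to exceed.\<close>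
    obtain f0 where f0: "f0 \<in> E" "Lp_int p \<Omega> f0 \<le> 1"
        "ennreal ((1/s) powr q * (2 powr q * (K + G))) < Lp_int q \<Omega> f0"
      using neg by (meson not_less)
    define f where "f = (\<lambda>z. complex_of_real s * f0 z)"
    have f: "f \<in> E" unfolding f_def by (rule Ec[OF f0(1)])
    have "Lp_int p \<Omega> f = ennreal (s powr p) * Lp_int p \<Omega> f0"
      unfolding f_def using Lp_int_cmult[OF assms(1) hol[OF f0(1)], of p "complex_of_real s"] s by simp
    also have "\<dots> \<le> ennreal (s powr p) * 1"
      by (intro mult_left_mono f0) simp
    finally have 1: "Lp_int p \<Omega> f \<le> ennreal \<eta>" using s by simp
    have "ennreal K < Lp_int q \<Omega> (\<lambda>z. g z + f z)"
    proof (rule ccontr)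
      assume "\<not> ?thesis"
      then have le: "Lp_int q \<Omega> (\<lambda>z. g z + f z) \<le> ennreal K" by simp
      have "Lp_int q \<Omega> f = Lp_int q \<Omega> (\<lambda>z. (g z + f z) - g z)" by simp
      also have "\<dots> \<le> ennreal (2 powr q) * (Lp_int q \<Omega> (\<lambda>z. g z + f z) + Lp_int q \<Omega> g)"
        by (rule Lp_int_diff_le) (use assms hol Eadd f g in auto)
      also have "\<dots> \<le> ennreal (2 powr q) * (ennreal K + ennreal G)"
        unfolding G(2) by (intro mult_left_mono add_right_mono le) simp
      also have "\<dots> = ennreal (2 powr q * (K + G))"
        using K G by (simp add: ennreal_mult flip: ennreal_plus)
      finally have fq: "Lp_int q \<Omega> f \<le> ennreal (2 powr q * (K + G))" .
      have "f0 = (\<lambda>z. complex_of_real (1/s) * f z)"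
        using s by (auto simp: f_def)
      then have "Lp_int q \<Omega> f0 = ennreal ((1/s) powr q) * Lp_int q \<Omega> f"
        using Lp_int_cmult[OF assms(1) hol[OF f], of q "complex_of_real (1/s)"] s
        by (simp only: norm_of_real) simp
      also have "\<dots> \<le> ennreal ((1/s) powr q) * ennreal (2 powr q * (K + G))"
        by (intro mult_left_mono fq) simp
      also have "\<dots> = ennreal ((1/s) powr q * (2 powr q * (K + G)))"
        using K G by (simp only: ennreal_mult[symmetric] powr_ge_zero mult_nonneg_nonneg add_nonneg_nonneg)
      finally show False using f0(3) by simp
    qed
    with f 1 show ?thesis by blast
  qed
  \<comment> \<open>A state is a pair of a partial sum and a tolerance. \<open>P\<close> starts the
    sums at 0, so that the increments telescope. \<open>Q\<close> demands an increment small
    relative to the old tolerance, in the form required by \<open>Bergman_series\<close>, and a new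
    tolerance within which every holomorphic function has q-integral above n.\<close>
  define P where "P n x \<longleftrightarrow> fst x \<in> E \<and> 0 < snd x \<and> snd x \<le> (1::real) \<and> (n = (0::nat) \<longrightarrow> fst x = (\<lambda>z. 0))" for n x
  define Q where "Q n x y \<longleftrightarrow> snd y \<le> snd x
    \<and> Lp_int p \<Omega> (\<lambda>z. fst y z - fst x z) \<le> ennreal (((1/2) ^ Suc n) powr p * ((1/2) ^ Suc n * snd x))
    \<and> (\<forall>h. holomorphic_n h \<Omega> \<longrightarrow> Lp_int p \<Omega> (\<lambda>z. fst y z - h z) \<le> ennreal (snd y)
          \<longrightarrow> ennreal (real n) < Lp_int q \<Omega> h)" for n :: nat and x y :: "(complex^'n \<Rightarrow> complex) \<times> real"
  have "\<exists>x. \<forall>n. P n (x n) \<and> Q n (x n) (x (Suc n))"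
  proof (rule dependent_nat_choice)
    show "\<exists>x. P 0 x"
      by (rule exI[of _ "(\<lambda>z. 0, 1)"]) (simp add: P_def E0)
  next
    fix x n assume "P n x"
    then have x: "fst x \<in> E" "0 < snd x" "snd x \<le> 1" by (auto simp: P_def)
    have "0 < ((1/2) ^ Suc n) powr p * ((1/2) ^ Suc n * snd x)" using x by simp
    from perturb[OF x(1) this, of "real n"] obtain f where f: "f \<in> E"
      "Lp_int p \<Omega> f \<le> ennreal (((1/2) ^ Suc n) powr p * ((1/2) ^ Suc n * snd x))"
      "ennreal (real n) < Lp_int q \<Omega> (\<lambda>z. fst x z + f z)" by auto
    have g: "(\<lambda>z. fst x z + f z) \<in> E" by (rule Eadd[OF x(1) f(1)])
    obtain \<delta> where \<delta>: "\<delta> > 0" "\<And>h. holomorphic_n h \<Omega> \<Longrightarrow> Lp_int p \<Omega> (\<lambda>z. fst x z + f z - h z) \<le> ennreal \<delta>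
        \<Longrightarrow> ennreal (real n) < Lp_int q \<Omega> h"
      using Lp_int_lower_semicontinuous[OF assms(1-3) hol[OF g] f(3)] by blast
    \<comment> \<open>The minimum keeps the tolerances decreasing while respecting the radius given
      by semicontinuity.\<close>
    let ?y = "(\<lambda>z. fst x z + f z, min \<delta> (snd x))"
    have "P (Suc n) ?y" using g \<delta> x by (simp add: P_def)
    moreover have "Q n x ?y"
    proof -
      have "ennreal (min \<delta> (snd x)) \<le> ennreal \<delta>" by (intro ennreal_leI) simp
      then show ?thesis using f(2) \<delta>(2) unfolding Q_def by (auto intro: order_trans)
    qed
    ultimately show "\<exists>y. P (Suc n) y \<and> Q n x y" by blast
  qed
  then obtain x where x: "\<And>n. P n (x n)" "\<And>n. Q n (x n) (x (Suc n))" by blast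
  define g where "g n = fst (x n)" for n
  define \<epsilon> where "\<epsilon> n = snd (x n)" for n
  have g: "g n \<in> E" "g 0 = (\<lambda>z. 0)" for n
    using x(1)[of n] x(1)[of 0] by (auto simp: P_def g_def)
  have \<epsilon>: "0 < \<epsilon> n" "\<epsilon> n \<le> 1" "\<epsilon> (Suc n) \<le> \<epsilon> n" for n
    using x(1)[of n] x(2)[of n] by (auto simp: P_def Q_def \<epsilon>_def)
  define f where "f k = (\<lambda>z. g (Suc k) z - g k z)" for k
  have f: "Lp_int p \<Omega> (f k) \<le> ennreal (((1/2) ^ Suc k) powr p * ((1/2) ^ Suc k * \<epsilon> k))" for k
    using x(2)[of k] by (simp add: Q_def f_def g_def \<epsilon>_def)
  have holf: "holomorphic_n (f k) \<Omega>" for k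
    unfolding f_def by (intro holomorphic_n_diff hol g)
  have sumf: "(\<Sum>k<n. f k z) = g n z" for n z
    unfolding f_def using sum_lessThan_telescope[of "\<lambda>k. g k z" n] g(2) by simp
  have dec: "decseq \<epsilon>" using \<epsilon>(3) by (simp add: decseq_Suc_iff)
  define h where "h = (\<lambda>z. \<Sum>k. f k z)"
  note series = Bergman_series[OF assms(1,2) holf dec less_imp_le[OF \<epsilon>(1)] \<epsilon>(2) f, folded h_def, unfolded sumf]
  have holh: "holomorphic_n h \<Omega>" using series(1) unfolding h_def .
  have dist: "Lp_int p \<Omega> (\<lambda>z. g n z - h z) \<le> ennreal (\<epsilon> n * (1/2) ^ n)" for n
    using series(2)[of n] unfolding h_def .
  have half: "\<epsilon> n * (1/2) ^ n \<le> \<epsilon> n" "\<epsilon> n * (1/2) ^ n \<le> (1/2) ^ n" for n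
    using mult_left_le[of "(1/2) ^ n" "\<epsilon> n"] mult_left_le_one_le[of "(1/2) ^ n" "\<epsilon> n"]
      power_le_one[of "1/2::real" n] less_imp_le[OF \<epsilon>(1)[of n]] \<epsilon>(2)[of n] by simp_all
  have big: "ennreal (real n) < Lp_int q \<Omega> h" for n
  proof -
    \<comment> \<open>The guarantee of \<open>Q\<close> at stage n concerns the state with index
      \<open>Suc n\<close>, so the limit has to lie within that state's tolerance.\<close>
    have "Lp_int p \<Omega> (\<lambda>z. g (Suc n) z - h z) \<le> ennreal (\<epsilon> (Suc n))"
      using dist[of "Suc n"] half(1)[of "Suc n"] by (meson order_trans ennreal_leI)
    then show ?thesis
      using x(2)[of n] holh unfolding Q_def g_def \<epsilon>_def by blast
  qed
  have hB: "h \<in> Bergman (ereal p) \<Omega>"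
  proof -
    \<comment> \<open>As \<open>g 0\<close> is zero, h is the negative of \<open>g 0 - h\<close>, so
      the error estimate at n = 0 already says that h has finite p-integral.\<close>
    have "Lp_int p \<Omega> (\<lambda>z. complex_of_real (-1) * (g 0 z - h z)) = Lp_int p \<Omega> (\<lambda>z. g 0 z - h z)"
      using Lp_int_cmult[OF assms(1) holomorphic_n_diff[OF hol[OF g(1)[of 0]] holh], of p "-1"] by simp
    also have "\<dots> < \<infinity>"
      using dist[of 0] by (rule le_less_trans) simp
    finally have "Lp_int p \<Omega> h < \<infinity>" using g(2) by simp
    moreover have "h z = 0" if "z \<notin> \<Omega>" for z
      unfolding h_def f_def using zero[OF g(1) that] by simp
    ultimately show ?thesis using holh by (simp add: Bergman_def)
  qed
  have "(\<lambda>k. Lp_norm p \<Omega> (\<lambda>z. g k z - h z)) \<longlonglongrightarrow> 0"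
  proof (rule Lim_null_comparison[where g = "\<lambda>k. ((1/2) ^ k) powr (1/p)"])
    show "\<forall>\<^sub>F k in sequentially. norm (Lp_norm p \<Omega> (\<lambda>z. g k z - h z)) \<le> ((1/2) ^ k) powr (1/p)"
    proof (intro always_eventually allI)
      fix k
      have "enn2real (Lp_int p \<Omega> (\<lambda>z. g k z - h z)) \<le> \<epsilon> k * (1/2) ^ k"
        using dist[of k] \<epsilon>(1)[of k] by (intro enn2real_leI) auto
      also have "\<dots> \<le> (1/2) ^ k" by (rule half)
      finally show "norm (Lp_norm p \<Omega> (\<lambda>z. g k z - h z)) \<le> ((1/2) ^ k) powr (1/p)"
        unfolding Lp_norm_def using assms by (simp add: powr_mono2)
    qed
    have "(\<lambda>k. (1/2::real) ^ k) \<longlonglongrightarrow> 0" by (intro LIMSEQ_power_zero) simp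
    then show "(\<lambda>k. ((1/2::real) ^ k) powr (1/p)) \<longlonglongrightarrow> 0"
      by (rule tendsto_zero_powrI[OF _ tendsto_const]) (use assms in auto)
  qed
  then have "h \<in> E"
    using closed hB g(1) unfolding Lp_closed_in_Bergman_def by blast
  then obtain t where "0 \<le> t" "Lp_int q \<Omega> h = ennreal t"
    using Eq[of h] by (cases "Lp_int q \<Omega> h") auto
  moreover obtain n :: nat where "t < real n" using reals_Archimedean2 by blast
  ultimately show False using big[of n] by (simp add: ennreal_less_iff)
qed

text \<open>Evaluation on \<open>P\<close> is an injective linear map into a finite-dimensional
  space. Induction on the points builds a spanning set: if some g in \<open>E\<close> does not
  vanish at the new point, subtracting a multiple of g leads into the kernel of that evaluation,
  which is separated by the remaining points.\<close>

lemma finite_dim_complex_separating_points: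
  assumes "finite P" "complex_subspace E"
    and "\<And>f. f \<in> E \<Longrightarrow> (\<And>x. x \<in> P \<Longrightarrow> f x = 0) \<Longrightarrow> f = (\<lambda>z. 0)"
  shows "finite_dim_complex E"
  using assms
proof (induction P arbitrary: E rule: finite_induct)
  case empty
  then show ?case
    unfolding finite_dim_complex_def by (intro exI[of _ "{}"]) (auto dest: fun_cong)
next
  case (insert x P)
  have Eadd: "\<And>f g. f \<in> E \<Longrightarrow> g \<in> E \<Longrightarrow> (\<lambda>z. f z + g z) \<in> E"
    and Ec: "\<And>c f. f \<in> E \<Longrightarrow> (\<lambda>z. c * f z) \<in> E" and E0: "(\<lambda>z. 0) \<in> E"
    using insert.prems(1) unfolding complex_subspace_def by auto
  show ?case
  proof (cases "\<forall>f\<in>E. f x = 0")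
    case True
    then show ?thesis
      using insert.prems by (intro insert.IH) auto
  next
    case False
    then obtain g where g: "g \<in> E" "g x \<noteq> 0" by auto
    define E' where "E' = {f \<in> E. f x = 0}"
    have "complex_subspace E'"
      using insert.prems(1) unfolding complex_subspace_def E'_def by auto
    moreover have "f = (\<lambda>z. 0)" if "f \<in> E'" "\<And>y. y \<in> P \<Longrightarrow> f y = 0" for f
      using insert.prems(2) that unfolding E'_def by blast
    ultimately have "finite_dim_complex E'" by (rule insert.IH)
    then obtain B where B: "finite B" "B \<subseteq> E'" "\<And>f. f \<in> E' \<Longrightarrow> \<exists>c. \<forall>z. f z = (\<Sum>b\<in>B. c b * b z)"
      unfolding finite_dim_complex_def by blast
    have gB: "g \<notin> B" using B(2) g by (auto simp: E'_def)
    have "\<exists>c. \<forall>z. f z = (\<Sum>b\<in>insert g B. c b * b z)" if f: "f \<in> E" for f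
    proof -
      have "(\<lambda>z. f z + (- (f x / g x)) * g z) \<in> E"
        using Eadd[OF f Ec[OF g(1)]] .
      then have "(\<lambda>z. f z + (- (f x / g x)) * g z) \<in> E'"
        using g by (simp add: E'_def)
      from B(3)[OF this] obtain c where c: "\<And>z. f z + (- (f x / g x)) * g z = (\<Sum>b\<in>B. c b * b z)"
        by blast
      have "f z = (\<Sum>b\<in>insert g B. (c(g := f x / g x)) b * b z)" for z
      proof -
        have "(\<Sum>b\<in>B. (c(g := f x / g x)) b * b z) = (\<Sum>b\<in>B. c b * b z)"
          using gB by (intro sum.cong) auto
        then show ?thesis using c[of z] B(1) gB by (simp add: algebra_simps)
      qed
      then show ?thesis by blast
    qed
    moreover have "insert g B \<subseteq> E" using B(2) g by (auto simp: E'_def)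
    ultimately show ?thesis
      unfolding finite_dim_complex_def using B(1) by (intro exI[of _ "insert g B"]) auto
  qed
qed

subsection \<open>Finitely many points determine an element\<close>

text \<open>With vanishing integral every s > 0 is admissible in \<open>Bergman_point_bound\<close>;
  let s tend to 0.\<close>

lemma Lp_int_eq_0_imp:
  fixes f :: "complex^'n \<Rightarrow> complex"
  assumes "open \<Omega>" "holomorphic_n f \<Omega>" "1 \<le> p" "Lp_int p \<Omega> f = 0" "z \<in> \<Omega>"
  shows "f z = 0"
proof -
  obtain r where r: "0 < r" "ball z r \<subseteq> \<Omega>"
    using assms(1,5) unfolding open_contains_ball by meson
  let ?M = "1 + 1 / measure lborel (ball (0::complex^'n) r)"
  have "norm (f z) \<le> s * ?M" if "0 < s" for s
    by (rule Bergman_point_bound[OF assms(1-3) _ that r(2,1)]) (simp add: assms(4))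
  moreover have "?M > 0" using content_ball_pos[OF r(1), of "0::complex^'n"] by (simp add: add_pos_pos)
  ultimately have "norm (f z) \<le> 0 + e" if "0 < e" for e
    using that divide_pos_pos[of e ?M] by (metis add.left_neutral less_irrefl nonzero_eq_divide_eq)
  then have "norm (f z) \<le> 0"
    by (rule field_le_epsilon)
  then show ?thesis by simp
qed

text \<open>Truncation at level l: up to l the first term dominates, and beyond l the factor
  \<open>t powr (p - q)\<close> is at most \<open>l powr (p - q)\<close>, because the exponent is
  negative. A large l makes the coefficient of the q-th power small.\<close>

lemma powr_le_interpolation:
  fixes t :: real
  assumes "0 < p" "p < q" "0 < l" "0 \<le> t"
  shows "t powr p \<le> l powr p + l powr (p - q) * t powr q"
proof (cases "t \<le> l")
  case True
  then show ?thesis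
    using powr_mono2[of p t l] assms by (simp add: add_increasing2)
next
  case False
  have "t powr p = t powr (p - q) * t powr q"
    by (simp flip: powr_add)
  also have "\<dots> \<le> l powr (p - q) * t powr q"
    using False assms by (intro mult_right_mono powr_mono2') auto
  finally show ?thesis by (simp add: add_increasing)
qed

text \<open>The p-integral is bounded by three contributions of at most 1/4 each: values on
  \<open>K\<close>, values up to l off \<open>K\<close>, and larger values off \<open>K\<close>. The
  total 3/4 is strictly below 1, which contradicts a normalisation to exactly 1.\<close>

lemma Bergman_finite_determination:
  fixes \<Omega> :: "(complex^'n) set"
  assumes "open \<Omega>" "bounded \<Omega>" "1 \<le> p" "p < q"
  obtains P where "finite P"
    "\<And>f. holomorphic_n f \<Omega> \<Longrightarrow> Lp_int p \<Omega> f \<le> 1 \<Longrightarrow> Lp_int q \<Omega> f \<le> ennreal C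
       \<Longrightarrow> (\<And>x. x \<in> P \<Longrightarrow> f x = 0) \<Longrightarrow> Lp_int p \<Omega> f < 1"
proof -
  \<comment> \<open>\<open>C\<close> carries no sign condition; its replacement must be positive for
    the next choice, which solves \<open>l powr (p - q) * C' = 1/4\<close> for l.\<close>
  define C' where "C' = max C 1"
  have C': "C \<le> C'" "1 \<le> C'" by (auto simp: C'_def)
  define l where "l = (4 * C') powr (1 / (q - p))"
  have l: "0 < l" using C' by (simp add: l_def)
  have lC: "l powr (p - q) * C' = 1/4"
  proof -
    have "1 / (q - p) * (p - q) = -1" using assms by (simp add: field_simps)
    then have "l powr (p - q) = (4 * C') powr (-1)" by (simp only: l_def powr_powr)
    also have "\<dots> = 1 / (4 * C')" using C' by (simp add: powr_minus_divide)
    finally show ?thesis using C' by simp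
  qed
  define \<eta> where "\<eta> = 1 / (4 * l powr p)"
  have \<eta>: "0 < \<eta>" "l powr p * \<eta> = 1/4" using l by (auto simp: \<eta>_def)
  have fin: "emeasure lborel \<Omega> < \<infinity>" using assms(2) by (rule emeasure_bounded_finite)
  then obtain V where V: "0 \<le> V" "emeasure lborel \<Omega> = ennreal V"
    by (metis ennreal_cases less_irrefl infinity_ennreal_def)
  have "\<Omega> \<in> sets lebesgue" using assms(1) by simp
  then obtain K where K: "closed K" "K \<subseteq> \<Omega>" "emeasure lebesgue (\<Omega> - K) < ennreal \<eta>"
    by (rule sets_lebesgue_inner_closed[OF _ \<eta>(1)])
  have [measurable]: "\<Omega> \<in> sets borel" "K \<in> sets borel" using assms(1) K(1) by auto
  then have "\<Omega> - K \<in> sets borel" by simp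
  then have K3: "emeasure lborel (\<Omega> - K) \<le> ennreal \<eta>" using K(3) by simp
  have cK: "compact K" using K(1,2) assms(2) bounded_subset compact_eq_bounded_closed by blast
  obtain R where R: "0 < R" "(\<Union>x\<in>K. ball x R) \<subseteq> \<Omega>"
    using compact_subset_open_imp_ball_epsilon_subset[OF cK assms(1) K(2)] by blast
  define r where "r = R / 3"
  have r: "0 < r" "\<And>x. x \<in> K \<Longrightarrow> ball x (3 * r) \<subseteq> \<Omega>" using R by (auto simp: r_def)
  obtain L where L: "0 \<le> L" "\<And>f x y. holomorphic_n f \<Omega> \<Longrightarrow> Lp_int p \<Omega> f \<le> 1
     \<Longrightarrow> ball x (3 * r) \<subseteq> \<Omega> \<Longrightarrow> y \<in> ball x r \<Longrightarrow> norm (f y - f x) \<le> L * norm (y - x)"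
    using Bergman_Lipschitz[OF assms(1,3) r(1)] by blast
  \<comment> \<open>\<open>d \<le> r\<close> keeps each net ball within reach of the Lipschitz
    estimate. The other bound gives \<open>L * d \<le> 1 / (4 * (V + 1)) \<le> 1\<close>, so the
    p-th power of \<open>L * d\<close> is no larger than \<open>L * d\<close> itself, and
    multiplying by the volume \<open>V\<close> leaves at most 1/4. The added ones guard against
    \<open>L\<close> or \<open>V\<close> being 0.\<close>
  define d where "d = min r (1 / ((L + 1) * (4 * (V + 1))))"
  have d: "0 < d" "d \<le> r" using r L V by (auto simp: d_def)
  have Ld: "(L * d) powr p * V \<le> 1/4"
  proof -
    have "L * d \<le> (L + 1) * (1 / ((L + 1) * (4 * (V + 1))))"
      using L d by (intro mult_mono) (auto simp: d_def)
    also have "\<dots> = 1 / (4 * (V + 1))" using L by simp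
    finally have le: "L * d \<le> 1 / (4 * (V + 1))" .
    also have "\<dots> \<le> 1" using V by simp
    finally have "(L * d) powr p \<le> (L * d) powr 1"
      using assms L d by (intro powr_mono') auto
    also have "\<dots> \<le> 1 / (4 * (V + 1))" using le L d by simp
    finally have "(L * d) powr p * V \<le> 1 / (4 * (V + 1)) * V"
      using V by (intro mult_right_mono)
    also have "\<dots> \<le> 1/4" using V by (simp add: field_simps)
    finally show ?thesis .
  qed
  have "K \<subseteq> (\<Union>x\<in>K. ball x d)" using d by auto
  then obtain P where P: "P \<subseteq> K" "finite P" "K \<subseteq> (\<Union>x\<in>P. ball x d)"
    using compactE_image[OF cK, of K "\<lambda>x. ball x d"] by auto
  show thesis
  proof
    show "finite P" by (rule P)
    fix f assume f: "holomorphic_n f \<Omega>" "Lp_int p \<Omega> f \<le> 1" "Lp_int q \<Omega> f \<le> ennreal C"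
      "\<And>x. x \<in> P \<Longrightarrow> f x = 0"
    have onK: "norm (f y) powr p \<le> (L * d) powr p" if y: "y \<in> K" for y
    proof -
      obtain x where x: "x \<in> P" "y \<in> ball x d" using P(3) y by blast
      have "norm (f y - f x) \<le> L * norm (y - x)"
        using x d P(1) by (intro L(2) f r) auto
      also have "\<dots> \<le> L * d"
        using x L(1) by (intro mult_left_mono) (auto simp: dist_norm norm_minus_commute)
      finally show ?thesis using f(4)[OF x(1)] assms by (intro powr_mono2) auto
    qed
    have [measurable]: "(\<lambda>z. ennreal (norm (f z) powr q) * indicator \<Omega> z) \<in> borel_measurable lborel"
      using borel_measurable_holomorphic_powr[OF assms(1) f(1)] by simp
    have "Lp_int p \<Omega> f \<le> (\<integral>\<^sup>+z. ennreal ((L * d) powr p) * indicator \<Omega> z + (ennreal (l powr p) * indicator (\<Omega> - K) z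
        + ennreal (l powr (p - q)) * (ennreal (norm (f z) powr q) * indicator \<Omega> z)) \<partial>lborel)"
      unfolding Lp_int_eq_lborel[OF assms(1) f(1)]
    proof (rule nn_integral_mono)
      fix z
      consider "z \<notin> \<Omega>" | "z \<in> K" "z \<in> \<Omega>" | "z \<in> \<Omega> - K" using K(2) by auto
      then show "ennreal (norm (f z) powr p) * indicator \<Omega> z \<le> ennreal ((L * d) powr p) * indicator \<Omega> z + (ennreal (l powr p) * indicator (\<Omega> - K) z
        + ennreal (l powr (p - q)) * (ennreal (norm (f z) powr q) * indicator \<Omega> z))"
      proof cases
        case 2
        then show ?thesis using onK[OF 2(1)] by (simp add: add_increasing2 ennreal_leI)
      next
        case 3
        have "ennreal (norm (f z) powr p) \<le> ennreal (l powr p + l powr (p - q) * norm (f z) powr q)"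
          using powr_le_interpolation[of p q l "norm (f z)"] assms l by (intro ennreal_leI) auto
        then have "ennreal (norm (f z) powr p) \<le> ennreal (l powr p) + ennreal (l powr (p - q)) * ennreal (norm (f z) powr q)"
          by (simp add: ennreal_mult)
        then show ?thesis using 3 by (simp add: add_increasing)
      qed simp
    qed
    also have "\<dots> = ennreal ((L * d) powr p) * emeasure lborel \<Omega> + (ennreal (l powr p) * emeasure lborel (\<Omega> - K)
        + ennreal (l powr (p - q)) * Lp_int q \<Omega> f)"
      unfolding Lp_int_eq_lborel[OF assms(1) f(1)]
      by (simp add: nn_integral_add nn_integral_cmult)
    also have "\<dots> \<le> ennreal ((L * d) powr p) * ennreal V + (ennreal (l powr p) * ennreal \<eta>
        + ennreal (l powr (p - q)) * ennreal C')"
      using order_trans[OF f(3) ennreal_leI[OF C'(1)]] K3 V(2) by (intro add_mono mult_left_mono) auto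
    also have "\<dots> = ennreal ((L * d) powr p * V + (l powr p * \<eta> + l powr (p - q) * C'))"
      using V \<eta> C' by (simp add: ennreal_mult)
    also have "\<dots> \<le> ennreal (3/4)"
      using Ld \<eta>(2) lC by (intro ennreal_leI) linarith
    also have "\<dots> < 1" by (simp add: ennreal_less_one_iff)
    finally show "Lp_int p \<Omega> f < 1" .
  qed
qed

text \<open>An element vanishing on \<open>P\<close> with p-integral t > 0 could be scaled by
  \<open>t powr (- 1 / p)\<close> to p-integral exactly 1. Its zeros persist and the uniform q-bound
  applies, so its p-integral would also be below 1. Hence t = 0, and f vanishes on
  \<open>\<Omega>\<close> by the pointwise bound and elsewhere by the convention in
  \<open>Bergman\<close>.\<close>

lemma finite_dim_complex_Bergman:
  fixes \<Omega> :: "(complex^'n) set"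
  assumes "open \<Omega>" "bounded \<Omega>" "1 \<le> p" "p < q"
    and EB: "E \<subseteq> Bergman (ereal p) \<Omega>" and sub: "complex_subspace E"
    and closed: "Lp_closed_in_Bergman p \<Omega> E"
    and Eq: "\<And>f. f \<in> E \<Longrightarrow> Lp_int q \<Omega> f < \<infinity>"
  shows "finite_dim_complex E"
proof -
  have "0 < q" using assms by simp
  obtain C where C: "\<And>f. f \<in> E \<Longrightarrow> Lp_int p \<Omega> f \<le> 1 \<Longrightarrow> Lp_int q \<Omega> f \<le> ennreal C"
    using Bergman_uniform_bound[OF assms(1,3) \<open>0 < q\<close> EB sub closed Eq] by blast
  obtain P where P: "finite P"
    "\<And>f. holomorphic_n f \<Omega> \<Longrightarrow> Lp_int p \<Omega> f \<le> 1 \<Longrightarrow> Lp_int q \<Omega> f \<le> ennreal C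
       \<Longrightarrow> (\<And>x. x \<in> P \<Longrightarrow> f x = 0) \<Longrightarrow> Lp_int p \<Omega> f < 1"
    using Bergman_finite_determination[OF assms(1-4)] by blast
  show ?thesis
  proof (rule finite_dim_complex_separating_points[OF P(1) sub])
    fix f assume f: "f \<in> E" "\<And>x. x \<in> P \<Longrightarrow> f x = 0"
    have B: "holomorphic_n f \<Omega>" "\<And>z. z \<notin> \<Omega> \<Longrightarrow> f z = 0" "Lp_int p \<Omega> f < \<infinity>"
      using EB f(1) by (auto simp: Bergman_def)
    obtain t where t: "0 \<le> t" "Lp_int p \<Omega> f = ennreal t"
      using B(3) by (cases "Lp_int p \<Omega> f") auto
    have "t = 0"
    proof (rule ccontr)
      assume "t \<noteq> 0"
      define s where "s = t powr (- 1 / p)"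
      have s: "0 < s" "s powr p * t = 1"
      proof -
        have "s powr p = t powr (- 1 / p * p)" by (simp only: s_def powr_powr)
        also have "\<dots> = 1 / t" using t assms(3) by (simp add: powr_minus_divide)
        finally show "0 < s" "s powr p * t = 1" using t \<open>t \<noteq> 0\<close> by (auto simp: s_def)
      qed
      define g where "g = (\<lambda>z. complex_of_real s * f z)"
      have g: "g \<in> E" using sub f(1) unfolding complex_subspace_def g_def by blast
      have "Lp_int p \<Omega> g = ennreal (s powr p) * ennreal t"
        using Lp_int_cmult[OF assms(1) B(1), of p "complex_of_real s"] s t by (simp add: g_def)
      also have "\<dots> = 1" using s t by (simp flip: ennreal_mult)
      finally have g1: "Lp_int p \<Omega> g = 1" .
      have "Lp_int p \<Omega> g < 1"
      proof (rule P(2))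
        show "holomorphic_n g \<Omega>" unfolding g_def by (rule holomorphic_n_cmult[OF B(1)])
        show "Lp_int q \<Omega> g \<le> ennreal C" by (rule C[OF g]) (simp add: g1)
        show "g x = 0" if "x \<in> P" for x using f(2)[OF that] by (simp add: g_def)
      qed (simp add: g1)
      then show False using g1 by simp
    qed
    then have "f z = 0" for z
      using B(2) Lp_int_eq_0_imp[OF assms(1) B(1) assms(3)] t by (cases "z \<in> \<Omega>") auto
    then show "f = (\<lambda>z. 0)" by blast
  qed
qed

section \<open>The case of infinite exponent and the conclusion\<close>

lemma Bergman_infinity_Lp_int_finite:
  fixes \<Omega> :: "(complex^'n) set"
  assumes "bounded \<Omega>" "f \<in> Bergman \<infinity> \<Omega>" "0 \<le> q"
  shows "Lp_int q \<Omega> f < \<infinity>"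
proof -
  obtain C where C: "AE z in lebesgue. z \<in> \<Omega> \<longrightarrow> norm (f z) \<le> C"
    using assms(2) by (auto simp: Bergman_def)
  obtain R where R: "\<Omega> \<subseteq> ball 0 R" using assms(1) bounded_subset_ballD by blast
  have "Lp_int q \<Omega> f \<le> (\<integral>\<^sup>+z. ennreal (\<bar>C\<bar> powr q) * indicator (ball (0::complex^'n) R) z \<partial>lebesgue)"
    unfolding Lp_int_def
  proof (rule nn_integral_mono_AE)
    show "AE z in lebesgue. ennreal (norm (f z) powr q) * indicator \<Omega> z
        \<le> ennreal (\<bar>C\<bar> powr q) * indicator (ball 0 R) z"
      using C
    proof eventually_elim
      case (elim z)
      have "norm (f z) powr q \<le> \<bar>C\<bar> powr q" if "z \<in> \<Omega>"
        using elim that assms(3) by (intro powr_mono2) auto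
      then show ?case
        using R by (auto simp: indicator_def ennreal_leI)
    qed
  qed
  also have "\<dots> = ennreal (\<bar>C\<bar> powr q) * emeasure lborel (ball (0::complex^'n) R)"
    by (simp add: nn_integral_cmult_indicator)
  also have "\<dots> < \<infinity>"
    using emeasure_lborel_ball_finite[of "0::complex^'n" R] by (simp add: ennreal_mult_less_top)
  finally show ?thesis .
qed

theorem theorem1p2:
  fixes \<Omega> :: "(complex^'n) set" and p :: real and q :: ereal
    and E :: "(complex^'n \<Rightarrow> complex) set"
  assumes "bounded_domain \<Omega>"
    and "1 \<le> p" and "ereal p < q"
    and "E \<subseteq> Bergman (ereal p) \<Omega>" and "complex_subspace E"
    and "Lp_closed_in_Bergman p \<Omega> E"
    and "E \<subseteq> Bergman q \<Omega>"
  shows "finite_dim_complex E"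
proof -
  have \<Omega>: "open \<Omega>" "bounded \<Omega>"
    using assms(1) by (auto simp: bounded_domain_def)
  \<comment> \<open>One finite exponent above p is enough: q itself or, when q is infinite, p + 1,
    since essentially bounded functions on a bounded set have finite integrals of every nonnegative
    power.\<close>
  obtain q' where q': "p < q'" "\<And>f. f \<in> E \<Longrightarrow> Lp_int q' \<Omega> f < \<infinity>"
  proof (cases q)
    case (real q')
    then show ?thesis
      using assms(3,7) by (intro that[of q']) (auto simp: Bergman_def)
  next
    case PInf
    then show ?thesis
      using assms(2,7) Bergman_infinity_Lp_int_finite[OF \<Omega>(2)] by (intro that[of "p + 1"]) auto
  qed (use assms(3) in simp)
  show ?thesis
    by (rule finite_dim_complex_Bergman[OF \<Omega> assms(2) q'(1) assms(4-6) q'(2)])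
qed

end
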